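(* Assume $0<i\le s<\infty$, $\inf_{t\in[0,1]}E[A^t]>\frac1m$ and $\Lambda>1$. Let $I_a$ and $I_q$ be the annealed and quenched speed-up rate functions on $[1,1/v]$ (defined in the context), and let $$\psi(\theta):=\ln\Big(E_{\mathbf Q}\Big[\sum_{j=1}^{\nu(e)}\omega(e,e_j)^\theta\Big]\Big).$$ Then $$I_a(1)=-\psi(1),\qquad I_q(1)=-\inf_{\theta\in]0,1]}\frac1\theta\psi(\theta).$$ In particular, $I_a(1)=I_q(1)$ if and only if $\psi'(1)\le\psi(1)$; otherwise $I_a(1)<I_q(1)$.
   Context: Tree: $\mathbb T$ is a Galton--Watson tree with root $e$ and offspring distribution $(q_k)_{k\ge0}$, with $q_0=0$ and finite mean $m=\sum_k kq_k>1$; $GW$ is its law. For a vertex $x$, $|x|$ is its generation ($|e|=0$), $\nu(x)$ its number of children, $x_1,\dots,x_{\nu(x)}$ its children, $\overleftarrow{x}$ its parent. An extra vertex $\overleftarrow{e}$ (generation $-1$) is added as parent of $e$. Environment: conditionally on $\mathbb T$, attach to the vertices $x$ i.i.d. positive random variables $A(x)$, distributed as a generic variable $A$, and set $\omega(x,x_j)=\frac{A(x_j)}{1+\sum_{l=1}^{\nu(x)}A(x_l)}$ for $1\le j\le\nu(x)$, $\omega(x,\overleftarrow{x})=\frac{1}{1+\sum_{l=1}^{\nu(x)}A(x_l)}$, and $\omega(\overleftarrow{e},e)=1$. Let $i=\operatorname{ess\,inf}A$, $s=\operatorname{ess\,sup}A$. $\mathbf P$ is the law of $\omega$ given $\mathbb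 T$, and $\mathbf Q=\int\mathbf P(\cdot)\,GW(d\mathbb T)$ is the joint law of tree and environment. Walk: given $\omega$, $P_\omega^y$ is the law of the Markov chain $(X_n)_{n\ge0}$ with $X_0=y$ and transition probabilities $\omega(\cdot,\cdot)$ (quenched law); $\mathbb Q^y(\cdot)=E_{\mathbf Q}[P_\omega^y(\cdot)]$ (annealed law). $\Lambda:=\mathrm{Leb}\{t\in\mathbb R: E[A^t]\le 1/q_1\}$ ($\Lambda=\infty$ if $q_1=0$). $v$ denotes the speed: the deterministic number with $|X_n|/n\to v$ a.s.; under the assumptions of the claim it is known that the walk is transient and $v>0$. $\tau_n:=\inf\{k\ge0:|X_k|=n\}$. Rate functions: $I_a,I_q:[1,1/v]\to\mathbb R_+$ are the (deterministic) functions such that for all $a<b$ with $b\in[1,1/v]$, $\lim_n\frac1n\ln\mathbb Q^e(\tau_n/n\in\,]a,b])=-I_a(b)$ and, for $\mathbf Q$-a.e. $\omega$, $\lim_n\frac1n\ln P_\omega^e(\tau_n/n\in\,]a,b])=-I_q(b)$; these functions exist, and are continuous, convex and strictly decreasing, with $I_a\le I_q$. *)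

theory Defs
  imports "HOL-Probability.Probability"
begin

text \<open>
  Trees are coded with Ulam--Harris words: the root is the empty word and the \<open>j\<close>-th child of \<open>x\<close>
  is \<open>x @ [j]\<close>, with \<open>j\<close> counted from 0. An environment gives every word \<open>x\<close> a pair
  \<open>(\<nu>(x), A(x))\<close>. The tree consists of the words all of whose proper prefixes \<open>y\<close> are followed by
  a letter \<open>j < \<nu>(y)\<close>. The labels of words outside the tree are never read by the walk below
  when it starts at the root or at the root's added parent, since it moves only along tree edges.
\<close>

type_synonym env = "nat list \<Rightarrow> nat \<times> real"

text \<open>\<open>None\<close> is the extra vertex added as parent of the root.\<close>

type_synonym vertex = "nat list option"

abbreviation root :: vertex where "root \<equiv> Some []"

definition num_children :: "env \<Rightarrow> nat list \<Rightarrow> nat" where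
  "num_children w x = fst (w x)"

definition Aval :: "env \<Rightarrow> nat list \<Rightarrow> real" where
  "Aval w x = snd (w x)"

fun gen :: "vertex \<Rightarrow> int" where
  "gen None = -1"
| "gen (Some x) = int (length x)"

definition parent :: "nat list \<Rightarrow> vertex" where
  "parent x = (if x = [] then None else Some (butlast x))"

fun omega :: "env \<Rightarrow> vertex \<Rightarrow> vertex \<Rightarrow> real" where
  "omega w None y = (if y = root then 1 else 0)"
| "omega w (Some x) y =
    (if y = parent x then 1 / (1 + (\<Sum>l<num_children w x. Aval w (x @ [l])))
     else if \<exists>j<num_children w x. y = Some (x @ [j])
       then Aval w (the y) / (1 + (\<Sum>l<num_children w x. Aval w (x @ [l])))
     else 0)"

text \<open>
  The law \<open>\<mu>\<close> of the generic variable \<open>A\<close> is a measure on the positive half-line, so every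
  environment in the space of \<open>environment_law q \<mu>\<close> has positive \<open>A\<close> everywhere. This measure is
  the joint law of the tree and the environment: all \<open>\<nu>(x)\<close> have law \<open>q\<close>, all \<open>A(x)\<close> have
  law \<open>\<mu>\<close>, and all these variables are independent.
\<close>

definition positive_law :: "real measure \<Rightarrow> bool" where
  "positive_law \<mu> \<longleftrightarrow> prob_space \<mu> \<and> sets \<mu> = sets (restrict_space borel {0<..})"

definition environment_law :: "nat pmf \<Rightarrow> real measure \<Rightarrow> env measure" where
  "environment_law q \<mu> = (\<Pi>\<^sub>M x\<in>UNIV. measure_pmf q \<Otimes>\<^sub>M \<mu>)"

text \<open>
  \<open>embed_pmf\<close> is meaningful only for a probability mass function; \<open>pmf_step\<close> below
  covers all environments with positive \<open>A\<close>.
\<close>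

definition step :: "env \<Rightarrow> vertex \<Rightarrow> vertex pmf" where
  "step w x = embed_pmf (omega w x)"

text \<open>
  The Ionescu-Tulcea kernels of the walk: \<open>X 0\<close> is \<open>y\<close>, and the conditional law of
  \<open>X (Suc k)\<close> given \<open>X 0, \<dots>, X k\<close> is \<open>omega w (X k)\<close>.
\<close>

definition walk_kernel :: "env \<Rightarrow> vertex \<Rightarrow> nat \<Rightarrow> (nat \<Rightarrow> vertex) \<Rightarrow> vertex measure" where
  "walk_kernel w y k X =
    measure_pmf (case k of 0 \<Rightarrow> return_pmf y | Suc l \<Rightarrow> step w (X l))"

definition quenched_law :: "env \<Rightarrow> vertex \<Rightarrow> (nat \<Rightarrow> vertex) measure" where
  "quenched_law w y =
    projective_family.lim UNIV
      (Ionescu_Tulcea.CI (walk_kernel w y) (\<lambda>_. count_space UNIV)) (\<lambda>_. count_space UNIV)"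

definition annealed_prob ::
    "nat pmf \<Rightarrow> real measure \<Rightarrow> vertex \<Rightarrow> (nat \<Rightarrow> vertex) set \<Rightarrow> real" where
  "annealed_prob q \<mu> y E = (\<integral>w. measure (quenched_law w y) E \<partial>environment_law q \<mu>)"

definition mean_offspring :: "nat pmf \<Rightarrow> real" where
  "mean_offspring q = (\<integral>k. real k \<partial>measure_pmf q)"

definition ess_inf :: "real measure \<Rightarrow> ereal" where
  "ess_inf \<mu> = Sup {z. AE a in \<mu>. z \<le> ereal a}"

definition ess_sup :: "real measure \<Rightarrow> ereal" where
  "ess_sup \<mu> = esssup \<mu> ereal"

definition moment :: "real measure \<Rightarrow> real \<Rightarrow> ennreal" where
  "moment \<mu> t = (\<integral>\<^sup>+ a. ennreal (a powr t) \<partial>\<mu>)"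

definition Lambda :: "nat pmf \<Rightarrow> real measure \<Rightarrow> ennreal" where
  "Lambda q \<mu> = (if pmf q 1 = 0 then \<infinity>
     else emeasure lborel {t. moment \<mu> t \<le> ennreal (1 / pmf q 1)})"

definition is_speed :: "nat pmf \<Rightarrow> real measure \<Rightarrow> real \<Rightarrow> bool" where
  "is_speed q \<mu> v \<longleftrightarrow>
    (AE w in environment_law q \<mu>. AE X in quenched_law w root.
       (\<lambda>n. real_of_int (gen (X n)) / real n) \<longlonglongrightarrow> v)"

text \<open>The value is \<open>\<infinity>\<close> if generation \<open>n\<close> is never visited.\<close>

definition hitting_time :: "nat \<Rightarrow> (nat \<Rightarrow> vertex) \<Rightarrow> ereal" where
  "hitting_time n X = (INF k\<in>{k. gen (X k) = int n}. ereal (real k))"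

definition hit_event :: "nat \<Rightarrow> real \<Rightarrow> real \<Rightarrow> (nat \<Rightarrow> vertex) set" where
  "hit_event n a b = {X. hitting_time n X / ereal (real n) \<in> {ereal a<..ereal b}}"

text \<open>
  For \<open>a < b\<close> and \<open>b \<ge> 1\<close> the probabilities below are positive for all large \<open>n\<close>, so the
  convention \<open>ln 0 = 0\<close> affects no limit.
\<close>

definition annealed_rate ::
    "nat pmf \<Rightarrow> real measure \<Rightarrow> real \<Rightarrow> (real \<Rightarrow> real) \<Rightarrow> bool" where
  "annealed_rate q \<mu> v I \<longleftrightarrow>
    (\<forall>a b. a < b \<longrightarrow> b \<in> {1..1 / v} \<longrightarrow>
      (\<lambda>n. 1 / real n * ln (annealed_prob q \<mu> root (hit_event n a b))) \<longlonglongrightarrow> - I b)"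

definition quenched_rate ::
    "nat pmf \<Rightarrow> real measure \<Rightarrow> real \<Rightarrow> (real \<Rightarrow> real) \<Rightarrow> bool" where
  "quenched_rate q \<mu> v I \<longleftrightarrow>
    (\<forall>a b. a < b \<longrightarrow> b \<in> {1..1 / v} \<longrightarrow>
      (AE w in environment_law q \<mu>.
        (\<lambda>n. 1 / real n * ln (measure (quenched_law w root) (hit_event n a b))) \<longlonglongrightarrow> - I b))"

definition psi :: "nat pmf \<Rightarrow> real measure \<Rightarrow> real \<Rightarrow> real" where
  "psi q \<mu> \<theta> =
    ln (\<integral>w. (\<Sum>j<num_children w []. omega w root (Some [j]) powr \<theta>) \<partial>environment_law q \<mu>)"

lemma environment_positive:
  assumes "positive_law \<mu>" "w \<in> space (environment_law q \<mu>)"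
  shows "Aval w x > 0"
proof -
  have "sets \<mu> = sets (restrict_space borel {0<..})"
    using assms(1) by (simp only: positive_law_def)
  from sets_eq_imp_space_eq[OF this] have space: "space \<mu> = {0<..}"
    by (simp add: space_restrict_space)
  have "w x \<in> space (measure_pmf q \<Otimes>\<^sub>M \<mu>)"
    using assms(2) unfolding environment_law_def space_PiM by (rule PiE_mem) (rule UNIV_I)
  then have "snd (w x) \<in> space \<mu>"
    unfolding space_pair_measure by (rule mem_Times_iff[THEN iffD1, THEN conjunct2])
  then show ?thesis
    unfolding Aval_def space by (rule greaterThan_iff[THEN iffD1])
qed

lemma pmf_step:
  assumes pos: "\<And>x. Aval w x > 0"
  shows "pmf (step w x) y = omega w x y"
proof -
  have nonneg: "0 \<le> omega w x y" for y
    by (cases x) (auto intro!: divide_nonneg_nonneg add_nonneg_nonneg sum_nonneg less_imp_le[OF pos])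
  have sum1: "(\<integral>\<^sup>+ y. ennreal (omega w x y) \<partial>count_space UNIV) = 1"
  proof (cases x)
    case None
    have "(\<integral>\<^sup>+ y. ennreal (omega w x y) \<partial>count_space UNIV) = (\<Sum>y\<in>{root}. ennreal (omega w x y))"
      by (rule nn_integral_count_space') (auto simp: None split: if_splits)
    then show ?thesis by (simp add: None)
  next
    case (Some u)
    define S where "S = 1 + (\<Sum>l<num_children w u. Aval w (u @ [l]))"
    define C where "C = (\<lambda>j. Some (u @ [j])) ` {..<num_children w u}"
    have S: "S > 0" unfolding S_def
      by (intro add_pos_nonneg sum_nonneg less_imp_le[OF pos]) auto
    have np: "parent u \<noteq> Some (u @ [j])" for j
    proof (cases "u = []")
      case False
      have "length (butlast u) \<noteq> length (u @ [j])" by simp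
      with False show ?thesis by (auto simp only: parent_def if_False option.inject)
    qed (simp add: parent_def)
    then have pC: "parent u \<notin> C" by (auto simp: C_def)
    have "(\<integral>\<^sup>+ y. ennreal (omega w x y) \<partial>count_space UNIV)
        = (\<Sum>y\<in>insert (parent u) C. ennreal (omega w x y))"
      by (rule nn_integral_count_space') (auto simp: Some C_def split: if_splits)
    also have "\<dots> = ennreal (\<Sum>y\<in>insert (parent u) C. omega w x y)"
      using nonneg by (simp add: sum_ennreal)
    also have "(\<Sum>y\<in>insert (parent u) C. omega w x y) = omega w x (parent u) + sum (omega w x) C"
      using pC by (simp add: C_def)
    also have "omega w x (parent u) = 1 / S"
      by (simp add: Some S_def)
    also have "sum (omega w x) C = (\<Sum>j<num_children w u. omega w x (Some (u @ [j])))"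
      unfolding C_def by (subst sum.reindex) (auto simp: inj_on_def)
    also have "\<dots> = (\<Sum>j<num_children w u. Aval w (u @ [j]) / S)"
      by (rule sum.cong) (auto simp: Some S_def np[symmetric])
    also have "1 / S + (\<Sum>j<num_children w u. Aval w (u @ [j]) / S) = 1"
      using S unfolding sum_divide_distrib[symmetric] add_divide_distrib[symmetric]
      by (simp add: S_def)
    finally show ?thesis by simp
  qed
  show ?thesis
    unfolding step_def by (rule pmf_embed_pmf[of "omega w x", OF nonneg sum1])
qed

lemma Ionescu_Tulcea_walk: "Ionescu_Tulcea (walk_kernel w y) (\<lambda>_. count_space UNIV)"
proof (rule Ionescu_Tulcea.intro)
  fix k
  have kernel: "(\<lambda>x. measure_pmf (p x)) \<in> count_space UNIV \<rightarrow>\<^sub>M subprob_algebra (count_space UNIV)"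
    for p :: "vertex \<Rightarrow> vertex pmf"
    unfolding measurable_count_space_eq1 by (rule Pi_I) (rule measure_pmf_in_subprob_algebra)
  show "walk_kernel w y k \<in> (\<Pi>\<^sub>M i\<in>{0..<k}. count_space UNIV) \<rightarrow>\<^sub>M subprob_algebra (count_space UNIV)"
  proof (cases k)
    case 0
    have "walk_kernel w y k = (\<lambda>X. measure_pmf (return_pmf y))"
      by (rule ext) (simp only: walk_kernel_def 0 nat.case)
    then show ?thesis
      by (simp only:) (rule measurable_const, rule measure_pmf_in_subprob_algebra)
  next
    case (Suc l)
    have "walk_kernel w y k = (\<lambda>X. measure_pmf (step w (X l)))"
      by (rule ext) (simp only: walk_kernel_def Suc nat.case)
    moreover have "(\<lambda>X. X l) \<in> (\<Pi>\<^sub>M i\<in>{0..<k}. count_space UNIV) \<rightarrow>\<^sub>M count_space (UNIV :: vertex set)"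
      by (rule measurable_component_singleton) (simp add: Suc)
    ultimately show ?thesis
      using measurable_compose[OF _ kernel] by (simp only:)
  qed
next
  show "prob_space (walk_kernel w y k X)" for k X
    unfolding walk_kernel_def by (rule measure_pmf.prob_space_axioms)
qed

end

theory Submission
  imports Defs
begin

text \<open>
  On \<open>\<tau>\<^sub>n \<le> n\<close> the walk climbs at every step, so the probability of this event given the
  environment is the cascade \<open>Z\<^sub>n = \<Sum>\<^bsub>|x| = n\<^esub> \<Prod> \<omega>\<close> along the branches of the tree. Its mean is
  \<open>exp (n \<psi>(1))\<close>. The quenched rate is the free energy of the cascade:
  let \<open>Z\<^sub>n(\<theta>)\<close> be the same sum with the weights raised to the power \<open>\<theta>\<close>, with mean
  \<open>exp (n \<psi>(\<theta>))\<close>. The upper bound is \<open>Z\<^sub>n(1) powr \<theta> \<le> Z\<^sub>n(\<theta>)\<close> for \<open>\<theta> \<le> 1\<close>.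
  For the lower bound let \<open>s\<close> be the smallest minimizer of \<open>\<psi>(\<theta>) / \<theta>\<close>. If \<open>b < s\<close>, then
  \<open>\<psi>(p b) < p \<psi>(b)\<close> for some \<open>p > 1\<close>, hence \<open>Z\<^sub>n(b) / E Z\<^sub>n(b)\<close> is bounded in \<open>L\<^sup>p\<close> and
  \<open>Z\<^sub>n(b)\<close> is comparable to its mean with a probability bounded away from 0. Convexity of
  \<open>\<theta> \<mapsto> ln Z\<^sub>n(\<theta>)\<close> transfers this from \<open>a < b < s\<close> to \<open>\<theta> = 1\<close>, and \<open>a, b \<rightarrow> s\<close>
  gives the minimum of \<open>\<psi>(\<theta>) / \<theta>\<close>. The limit is deterministic by assumption, so positive
  probability suffices.
\<close>

section \<open>Real inequalities and convex functions\<close>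

text \<open>The exponent p comes from strict minimality to the left of s: by convexity \<psi>(p b)
  lies on or below the chord from b to s, and that chord lies strictly below the ray from the origin
  through (b, \<psi>(b)). The minimum is attained because \<psi> tends to ln m > 0 at 0 and is
  negative at 1, where the step to the parent takes a positive share of the probability.

  The obstacle at \<theta> = 1 is that Z_n(1) is typically exponentially smaller than its mean when
  the minimum of \<psi>(\<theta>) / \<theta> lies below \<psi>(1), so its own moments say nothing
  about typical environments. Exponents left of s do not suffer from this. What limits them is
  integrability: only the mean of \<nu> is known to be finite, which confines p to p (1 - b) \<le>
  1, and p \<le> 2 keeps the power p - 1 subadditive. Since 0 < b < 1, some p > 1 always
  remains.\<close>

lemma powr_add_le:
  fixes a b r :: real
  assumes "0 \<le> a" "0 \<le> b" "0 \<le> r" "r \<le> 1"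
  shows "(a + b) powr r \<le> a powr r + b powr r"
proof (cases "a + b = 0")
  case True
  with assms show ?thesis by simp
next
  case False
  define s where "s = a + b"
  have s: "s > 0" using False assms by (simp add: s_def)
  \<comment> \<open>A fraction \<open>y = x / s\<close> in [0, 1] satisfies
    \<open>y \<le> y powr r\<close>; the fractions of the two summands add up to 1.\<close>
  have le: "x / s * s powr r \<le> x powr r" if x: "0 \<le> x" "x \<le> s" for x
  proof (cases "x = 0")
    case False
    then have "(x / s) powr 1 \<le> (x / s) powr r"
      using x s assms by (intro powr_mono') auto
    then have "x / s * s powr r \<le> (x / s) powr r * s powr r"
      using x s by (intro mult_right_mono) auto
    also have "\<dots> = x powr r"
      using x s by (simp add: powr_mult[symmetric])
    finally show ?thesis .
  qed simp
  have "s powr r = a / s * s powr r + b / s * s powr r"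
    using s by (simp add: s_def add_divide_distrib[symmetric] distrib_right[symmetric])
  also have "\<dots> \<le> a powr r + b powr r"
    using le[of a] le[of b] assms by (intro add_mono) (auto simp: s_def)
  finally show ?thesis by (simp add: s_def)
qed

lemma powr_sum_le:
  fixes u :: "'a \<Rightarrow> real"
  assumes "\<And>j. j \<in> I \<Longrightarrow> 0 \<le> u j" "0 \<le> r" "r \<le> 1"
  shows "(\<Sum>j\<in>I. u j) powr r \<le> (\<Sum>j\<in>I. u j powr r)"
  using assms(1)
proof (induction I rule: infinite_finite_induct)
  case (insert j I)
  have "(\<Sum>j\<in>insert j I. u j) powr r \<le> u j powr r + (\<Sum>j\<in>I. u j) powr r"
    using insert assms powr_add_le[of "u j" "\<Sum>j\<in>I. u j" r] by (simp add: sum_nonneg)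
  with insert show ?case by fastforce
qed auto

text \<open>Hoelder's inequality with exponents \<open>1 / (1 - t)\<close> and \<open>1 / t\<close>:
  Young's inequality is applied to the terms divided by their sums \<open>U\<close> and
  \<open>V\<close>, and its right-hand sides then add up to 1.\<close>

lemma sum_powr_mult_le:
  fixes u v :: "'a \<Rightarrow> real"
  assumes I: "finite I" and u: "\<And>j. j \<in> I \<Longrightarrow> 0 \<le> u j" and v: "\<And>j. j \<in> I \<Longrightarrow> 0 \<le> v j"
    and t: "0 < t" "t < 1"
  shows "(\<Sum>j\<in>I. u j powr (1 - t) * v j powr t) \<le> (\<Sum>j\<in>I. u j) powr (1 - t) * (\<Sum>j\<in>I. v j) powr t"
proof -
  define U V where "U = sum u I" and "V = sum v I"
  have nn: "0 \<le> U" "0 \<le> V" using u v by (auto simp: U_def V_def sum_nonneg)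
  show ?thesis
  proof (cases "U = 0 \<or> V = 0")
    case True
    then have "\<forall>j\<in>I. u j powr (1 - t) * v j powr t = 0"
      using u v I by (auto simp: U_def V_def sum_nonneg_eq_0_iff)
    then have "(\<Sum>j\<in>I. u j powr (1 - t) * v j powr t) = 0" by (rule sum.neutral)
    then show ?thesis by simp
  next
    case False
    then have pos: "U > 0" "V > 0" using nn by auto
    have "u j powr (1 - t) * v j powr t \<le> (U powr (1 - t) * V powr t) * ((1 - t) * (u j / U) + t * (v j / V))"
      if j: "j \<in> I" for j
    proof (cases "u j = 0 \<or> v j = 0")
      case True
      then have "u j powr (1 - t) * v j powr t = 0" by auto
      moreover have "0 \<le> (U powr (1 - t) * V powr t) * ((1 - t) * (u j / U) + t * (v j / V))"
        using u[OF j] v[OF j] pos t by (intro mult_nonneg_nonneg add_nonneg_nonneg) auto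
      ultimately show ?thesis by linarith
    next
      case False
      then have "u j > 0" "v j > 0" using u[OF j] v[OF j] by auto
      then have "(u j / U) powr (1 - t) * (v j / V) powr t \<le> (1 - t) * (u j / U) + t * (v j / V)"
        using pos t by (intro Youngs_inequality_0) auto
      then have "(U powr (1 - t) * V powr t) * ((u j / U) powr (1 - t) * (v j / V) powr t)
          \<le> (U powr (1 - t) * V powr t) * ((1 - t) * (u j / U) + t * (v j / V))"
        by (intro mult_left_mono) auto
      moreover have "(U powr (1 - t) * V powr t) * ((u j / U) powr (1 - t) * (v j / V) powr t)
          = u j powr (1 - t) * v j powr t"
        using pos \<open>u j > 0\<close> \<open>v j > 0\<close> by (simp add: powr_divide)
      ultimately show ?thesis by simp
    qed
    then have "(\<Sum>j\<in>I. u j powr (1 - t) * v j powr t)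
        \<le> (\<Sum>j\<in>I. (U powr (1 - t) * V powr t) * ((1 - t) * (u j / U) + t * (v j / V)))"
      by (rule sum_mono)
    also have "\<dots> = (U powr (1 - t) * V powr t) * ((1 - t) * (U / U) + t * (V / V))"
      by (simp only: U_def V_def sum_distrib_left[symmetric] sum.distrib sum_divide_distrib[symmetric])
    also have "\<dots> = U powr (1 - t) * V powr t" using pos by simp
    finally show ?thesis by (simp add: U_def V_def)
  qed
qed

text \<open>The difference of the two sides has derivative \<open>p\<close> times the subadditivity
  defect of the power \<open>p - 1\<close>, whose sign is right because
  \<open>p - 1 \<le> 1\<close>. The first two terms reappear in \<open>powr_add_lower\<close>, so
  replacing an independent random \<open>y\<close> by its mean costs only
  \<open>y powr p\<close>.\<close>

lemma powr_add_upper: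
  fixes x y p :: real
  assumes x: "0 \<le> x" and y: "0 \<le> y" and p: "1 < p" "p \<le> 2"
  shows "(x + y) powr p \<le> x powr p + p * x powr (p - 1) * y + y powr p"
proof -
  define g where "g z = x powr p + p * x powr (p - 1) * z + z powr p - (x + z) powr p" for z
  have "g 0 \<le> g y"
  proof (rule DERIV_nonneg_imp_increasing_open[OF y])
    fix z assume z: "0 < z" "z < y"
    have "(g has_real_derivative p * x powr (p - 1) + p * z powr (p - 1) - p * (x + z) powr (p - 1)) (at z)"
      unfolding g_def using x z by (auto intro!: derivative_eq_intros)
    moreover have "(x + z) powr (p - 1) \<le> x powr (p - 1) + z powr (p - 1)"
      using x z p by (intro powr_add_le) auto
    then have "0 \<le> p * (x powr (p - 1) + z powr (p - 1) - (x + z) powr (p - 1))"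
      using p by (intro mult_nonneg_nonneg) auto
    ultimately show "\<exists>d. (g has_real_derivative d) (at z) \<and> 0 \<le> d"
      by (auto simp: algebra_simps)
  next
    show "continuous_on {0..y} g"
      unfolding g_def using x p by (intro continuous_intros continuous_on_powr') auto
  qed
  moreover have "g 0 = 0" using p by (simp add: g_def)
  ultimately show ?thesis by (simp add: g_def)
qed

text \<open>Tangent line at \<open>x\<close> of the convex power \<open>p\<close>, obtained by
  monotonicity in \<open>z\<close> so that \<open>x = 0\<close> is included.\<close>

lemma powr_add_lower:
  fixes x y p :: real
  assumes x: "0 \<le> x" and y: "0 \<le> y" and p: "1 < p"
  shows "x powr p + p * x powr (p - 1) * y \<le> (x + y) powr p"
proof -
  define g where "g z = (x + z) powr p - x powr p - p * x powr (p - 1) * z" for z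
  have "g 0 \<le> g y"
  proof (rule DERIV_nonneg_imp_increasing_open[OF y])
    fix z assume z: "0 < z" "z < y"
    have "(g has_real_derivative p * (x + z) powr (p - 1) - p * x powr (p - 1)) (at z)"
      unfolding g_def using x z by (auto intro!: derivative_eq_intros)
    moreover have "x powr (p - 1) \<le> (x + z) powr (p - 1)"
      using x z p by (intro powr_mono2) auto
    then have "0 \<le> p * ((x + z) powr (p - 1) - x powr (p - 1))"
      using p by (intro mult_nonneg_nonneg) auto
    ultimately show "\<exists>d. (g has_real_derivative d) (at z) \<and> 0 \<le> d"
      by (auto simp: algebra_simps)
  next
    show "continuous_on {0..y} g"
      unfolding g_def using x p by (intro continuous_intros continuous_on_powr') auto
  qed
  then show ?thesis by (simp add: g_def)
qed

section \<open>Minimal slopes f(\<theta>) / \<theta>\<close>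

lemma INF_slope_eq:
  fixes f :: "real \<Rightarrow> real"
  assumes "\<And>\<theta>. 0 < \<theta> \<Longrightarrow> \<theta> \<le> 1 \<Longrightarrow> f s / s \<le> f \<theta> / \<theta>" and "0 < s" "s \<le> 1"
  shows "(INF \<theta>\<in>{0<..1}. 1 / \<theta> * f \<theta>) = f s / s"
  by (rule cInf_eq_minimum) (use assms in \<open>auto simp: image_iff\<close>)

text \<open>Near 0 the quotient is nonnegative and at 1 it is negative, so the search is confined to
  the compact interval \<open>{c..1}\<close>. The minimizers form a compact set, whose least element
  is \<open>s\<close>; leastness gives the strict inequality to its left.\<close>

lemma slope_minimizer:
  fixes f :: "real \<Rightarrow> real"
  assumes cont: "\<And>\<theta>. 0 < \<theta> \<Longrightarrow> isCont f \<theta>"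
    and c: "0 < c" and nonneg: "\<And>\<theta>. 0 < \<theta> \<Longrightarrow> \<theta> \<le> c \<Longrightarrow> 0 \<le> f \<theta>" and f1: "f 1 < 0"
  obtains s where "0 < s" "s \<le> 1" "\<And>\<theta>. 0 < \<theta> \<Longrightarrow> \<theta> \<le> 1 \<Longrightarrow> f s / s \<le> f \<theta> / \<theta>"
    "\<And>\<theta>. 0 < \<theta> \<Longrightarrow> \<theta> < s \<Longrightarrow> f s / s < f \<theta> / \<theta>"
proof -
  define k where "k \<theta> = f \<theta> / \<theta>" for \<theta>
  have c1: "c < 1" using nonneg[of 1] f1 by force
  have kc: "continuous_on {c..1} k"
    unfolding k_def using c cont by (intro continuous_at_imp_continuous_on ballI continuous_intros) auto
  obtain \<theta>0 where \<theta>0: "\<theta>0 \<in> {c..1}" "\<And>\<theta>. \<theta> \<in> {c..1} \<Longrightarrow> k \<theta>0 \<le> k \<theta>"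
    using continuous_attains_inf[OF compact_Icc _ kc] c1 by auto
  have "closed ({c..1} \<inter> k -` {k \<theta>0})"
    by (rule continuous_closed_preimage[OF kc]) auto
  then have "compact ({c..1} \<inter> k -` {k \<theta>0})"
    by (simp add: compact_eq_bounded_closed bounded_Int)
  then obtain s where s: "s \<in> {c..1}" "k s = k \<theta>0" and smin: "\<And>\<theta>. \<theta> \<in> {c..1} \<Longrightarrow> k \<theta> = k \<theta>0 \<Longrightarrow> s \<le> \<theta>"
    using compact_attains_inf[of "{c..1} \<inter> k -` {k \<theta>0}"] \<theta>0(1) by blast
  have below: "k s < k \<theta>" if "0 < \<theta>" "\<theta> < c" for \<theta>
  proof -
    have "k s \<le> k 1" using \<theta>0(2)[of 1] s c1 by simp
    also have "k 1 < 0" using f1 by (simp add: k_def)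
    also have "0 \<le> k \<theta>" using nonneg[of \<theta>] that by (simp add: k_def)
    finally show ?thesis .
  qed
  show thesis
  proof (rule that[of s])
    show "0 < s" "s \<le> 1" using s c by auto
    show "f s / s \<le> f \<theta> / \<theta>" if "0 < \<theta>" "\<theta> \<le> 1" for \<theta>
      using below[of \<theta>] \<theta>0(2)[of \<theta>] s that unfolding k_def[symmetric] by (cases "\<theta> < c") auto
    show "f s / s < f \<theta> / \<theta>" if "0 < \<theta>" "\<theta> < s" for \<theta>
      using below[of \<theta>] \<theta>0(2)[of \<theta>] smin[of \<theta>] s that unfolding k_def[symmetric] by (cases "\<theta> < c") force+
  qed
qed

text \<open>
  The lower bound on \<open>L\<close> is a secant of \<open>f\<close> evaluated at \<open>1\<close>. As its two nodes tend to the
  minimizer \<open>s\<close> of \<open>f \<theta> / \<theta>\<close>, it tends to the tangent at \<open>s\<close>, which passes through the origin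
  if \<open>s < 1\<close>.
\<close>

lemma minimal_slope_eqI:
  fixes f :: "real \<Rightarrow> real"
  assumes conv: "convex_on {0..} f"
    and diff: "\<And>\<theta>. 0 < \<theta> \<Longrightarrow> \<exists>D. (f has_real_derivative D) (at \<theta>)"
    and c: "0 < c" "\<And>\<theta>. 0 < \<theta> \<Longrightarrow> \<theta> \<le> c \<Longrightarrow> 0 \<le> f \<theta>" and f1: "f 1 < 0"
    and upper: "\<And>\<theta>. 0 < \<theta> \<Longrightarrow> \<theta> \<le> 1 \<Longrightarrow> \<theta> * L \<le> f \<theta>"
    and lower: "\<And>a b p. 0 < a \<Longrightarrow> a < b \<Longrightarrow> b < 1 \<Longrightarrow> 1 < p \<Longrightarrow> p \<le> 2 \<Longrightarrow> p * (1 - b) \<le> 1 \<Longrightarrow>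
      f (p * b) < p * f b \<Longrightarrow> f b + (1 - b) * ((f b - f a) / (b - a)) \<le> L"
  shows "L = (INF \<theta>\<in>{0<..1}. 1 / \<theta> * f \<theta>)"
proof -
  have cont: "isCont f \<theta>" if "0 < \<theta>" for \<theta>
    using diff[OF that] DERIV_isCont by blast
  obtain s where s: "0 < s" "s \<le> 1" and min: "\<And>\<theta>. 0 < \<theta> \<Longrightarrow> \<theta> \<le> 1 \<Longrightarrow> f s / s \<le> f \<theta> / \<theta>"
    and strict: "\<And>\<theta>. 0 < \<theta> \<Longrightarrow> \<theta> < s \<Longrightarrow> f s / s < f \<theta> / \<theta>"
    using slope_minimizer[OF cont c f1] by blast
  have secant: "f b + (1 - b) * ((f b - f a) / (b - a)) \<le> L" if ab: "0 < a" "a < b" "b < s" for a b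
  proof -
    have b: "0 < b" "b < 1" using ab s by auto
    \<comment> \<open>Upper limits for \<open>p\<close>: 2, the moment condition
      \<open>p * (1 - b) \<le> 1\<close>, and \<open>p * b < s\<close>. All three exceed 1, and
      \<open>p\<close> is the midpoint of 1 and their minimum, so it stays strictly below each of
      them.\<close>
    define r where "r = min 2 (min (1 / (1 - b)) (s / b))"
    define p where "p = (1 + r) / 2"
    have r: "1 < r" using b ab by (auto simp: r_def field_simps)
    have mid: "p < x" if "r \<le> x" for x using that r by (simp add: p_def)
    have "r \<le> 2" "r \<le> 1 / (1 - b)" "r \<le> s / b" by (simp_all add: r_def)
    then have p: "1 < p" "p \<le> 2" "p \<le> 1 / (1 - b)" "p < s / b"
      using r mid[of 2] mid[of "1 / (1 - b)"] mid[of "s / b"] by (simp_all only: less_imp_le) (simp add: p_def)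
    have p1: "p * (1 - b) \<le> 1" using p(3) b by (simp add: field_simps)
    have pb: "b < p * b" "p * b < s" using p b by (simp_all add: field_simps)
    define t where "t = (p * b - b) / (s - b)"
    have t: "0 < t" "t < 1" using pb ab by (auto simp: t_def field_simps)
    have "t * (s - b) = p * b - b" using ab by (simp add: t_def)
    then have eq: "p * b = (1 - t) * b + t * s" by (simp add: algebra_simps)
    have "f (p * b) \<le> (1 - t) * f b + t * f s"
      using convex_onD[OF conv, of t b s] t b s unfolding eq by simp
    also have "\<dots> < (1 - t) * f b + t * (s * (f b / b))"
    proof -
      have "f s < s * (f b / b)" using strict[of b] b ab s by (simp add: field_simps)
      then show ?thesis using t by (intro add_strict_left_mono mult_strict_left_mono) auto
    qed
    also have "\<dots> = ((1 - t) * b + t * s) * (f b / b)" using b by (simp add: algebra_simps)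
    also have "\<dots> = p * f b" unfolding eq[symmetric] using b by simp
    finally show ?thesis using ab b p p1 by (intro lower[of a b p]) auto
  qed
  \<comment> \<open>The nodes move one at a time: \<open>b\<close> tends to \<open>s\<close> by
    continuity with \<open>a\<close> fixed, then \<open>a\<close> tends to \<open>s\<close> and the
    difference quotient becomes \<open>D\<close>.\<close>
  have secant': "f s + (1 - s) * ((f s - f a) / (s - a)) \<le> L" if a: "0 < a" "a < s" for a
  proof (rule tendsto_upperbound)
    have "(f \<longlongrightarrow> f s) (at_left s)"
      using cont[OF s(1)] by (auto simp: isCont_def intro: tendsto_mono at_le)
    then show "((\<lambda>b. f b + (1 - b) * ((f b - f a) / (b - a))) \<longlongrightarrow> f s + (1 - s) * ((f s - f a) / (s - a))) (at_left s)"
      using a by (intro tendsto_intros) auto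
    show "eventually (\<lambda>b. f b + (1 - b) * ((f b - f a) / (b - a)) \<le> L) (at_left s)"
      using eventually_at_left_real[OF a(2)] by eventually_elim (use secant a in auto)
  qed simp
  obtain D where D: "(f has_real_derivative D) (at s)" using diff[OF s(1)] by blast
  have tangent: "f s + (1 - s) * D \<le> L"
  proof (rule tendsto_upperbound)
    have "((\<lambda>a. (f a - f s) / (a - s)) \<longlongrightarrow> D) (at_left s)"
      using has_field_derivative_at_within[OF D, of "{..<s}"] by (simp add: has_field_derivative_iff)
    moreover have "(f a - f s) / (a - s) = (f s - f a) / (s - a)" for a
      by (metis minus_diff_eq minus_divide_divide)
    ultimately show "((\<lambda>a. f s + (1 - s) * ((f s - f a) / (s - a))) \<longlongrightarrow> f s + (1 - s) * D) (at_left s)"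
      by (intro tendsto_intros) simp
    show "eventually (\<lambda>a. f s + (1 - s) * ((f s - f a) / (s - a)) \<le> L) (at_left s)"
      using eventually_at_left_real[OF s(1)] by eventually_elim (use secant' in auto)
  qed simp
  \<comment> \<open>At \<open>s = 1\<close> the minimum lies on the boundary and \<open>D\<close>
    need not equal \<open>f s / s\<close>, but its coefficient \<open>1 - s\<close> vanishes. An
    interior minimum is a critical point of \<open>f \<theta> / \<theta>\<close>.\<close>
  have "f s / s \<le> L"
  proof (cases "s = 1")
    case True
    then show ?thesis using tangent by simp
  next
    case False
    have "((\<lambda>\<theta>. f \<theta> / \<theta>) has_real_derivative (D * s - f s * 1) / (s * s)) (at s)"
      using s by (intro DERIV_divide D DERIV_ident) auto
    moreover have "0 < min s (1 - s)" using s False by simp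
    moreover have "\<forall>y. \<bar>s - y\<bar> < min s (1 - s) \<longrightarrow> f s / s \<le> f y / y"
      by (auto intro!: min)
    ultimately have "(D * s - f s * 1) / (s * s) = 0"
      by (rule DERIV_local_min)
    then have "D * s = f s" using s by simp
    then have "D = f s / s" using s by (simp add: field_simps)
    moreover have "f s + (1 - s) * (f s / s) = f s / s" using s by (simp add: field_simps)
    ultimately show ?thesis using tangent by simp
  qed
  moreover have "L \<le> f s / s" using upper[OF s] s by (simp add: field_simps)
  ultimately show ?thesis using INF_slope_eq[of f s, OF min s] by simp
qed

text \<open>The derivative of \<open>f \<theta> / \<theta>\<close> at 1 is \<open>D - f 1\<close>.
  If it is positive, the quotient is smaller slightly to the left of 1. If not, the tangent of the
  convex \<open>f\<close> at 1 lies above the ray \<open>\<theta> * f 1\<close> on (0, 1], so 1 is a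
  minimizer.\<close>

lemma INF_slope_eq_at_1_iff:
  fixes f :: "real \<Rightarrow> real"
  assumes conv: "convex_on {0..} f" and D: "(f has_real_derivative D) (at 1)"
    and bdd: "bdd_below ((\<lambda>\<theta>. 1 / \<theta> * f \<theta>) ` {0<..1})"
  shows "(INF \<theta>\<in>{0<..1}. 1 / \<theta> * f \<theta>) = f 1 \<longleftrightarrow> D \<le> f 1"
proof
  assume le: "D \<le> f 1"
  have "f 1 / 1 \<le> f \<theta> / \<theta>" if \<theta>: "0 < \<theta>" "\<theta> \<le> 1" for \<theta>
  proof (cases "\<theta> = 1")
    case False
    have "\<theta> * f 1 = f 1 - (1 - \<theta>) * f 1" by (simp add: algebra_simps)
    also have "\<dots> \<le> f 1 - (1 - \<theta>) * D" using le \<theta> by (intro diff_left_mono mult_left_mono) auto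
    also have "\<dots> \<le> f \<theta>"
      using convex_on_imp_above_tangent[OF conv _ _ _ has_field_derivative_at_within[OF D], of \<theta>] \<theta>
      by (simp add: algebra_simps)
    finally show ?thesis using \<theta> by (simp add: field_simps)
  qed simp
  then show "(INF \<theta>\<in>{0<..1}. 1 / \<theta> * f \<theta>) = f 1"
    using INF_slope_eq[of f 1] by simp
next
  assume eq: "(INF \<theta>\<in>{0<..1}. 1 / \<theta> * f \<theta>) = f 1"
  show "D \<le> f 1"
  proof (rule ccontr)
    assume "\<not> D \<le> f 1"
    moreover have "((\<lambda>\<theta>. f \<theta> / \<theta>) has_real_derivative (D * 1 - f 1 * 1) / (1 * 1)) (at 1)"
      by (intro DERIV_divide D DERIV_ident) auto
    ultimately obtain d where d: "0 < d" "\<And>h. 0 < h \<Longrightarrow> h < d \<Longrightarrow> f (1 - h) / (1 - h) < f 1 / 1"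
      using DERIV_pos_inc_left[of "\<lambda>\<theta>. f \<theta> / \<theta>"] by force
    define h where "h = min d 1 / 2"
    have h: "0 < h" "h < d" "h < 1" using d(1) by (auto simp: h_def)
    have "(INF \<theta>\<in>{0<..1}. 1 / \<theta> * f \<theta>) \<le> 1 / (1 - h) * f (1 - h)"
      using h by (intro cINF_lower bdd) auto
    also have "\<dots> < f 1" using d(2)[of h] h by simp
    finally show False using eq by simp
  qed
qed

section \<open>Climbing probability of the walk\<close>

lemma prob_space_quenched_law: "prob_space (quenched_law w y)"
proof -
  interpret IT: Ionescu_Tulcea "walk_kernel w y" "\<lambda>_. count_space UNIV"
    by (rule Ionescu_Tulcea_walk)
  \<comment> \<open>The marginal on the empty index set already carries the total mass, and it is a
    probability measure.\<close>
  show ?thesis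
    unfolding quenched_law_def
    by (rule prob_space_distrD[of "\<lambda>X. restrict X {}" _ "PiM {} (\<lambda>_. count_space UNIV)"])
       (use IT.distr_lim[of "{}"] IT.PF.prob_space_P[of "{}"] in \<open>auto intro!: measurable_restrict\<close>)
qed

lemma sets_quenched_law [measurable_cong]:
  "sets (quenched_law w y) = sets (\<Pi>\<^sub>M k\<in>UNIV. count_space UNIV)"
proof -
  interpret IT: Ionescu_Tulcea "walk_kernel w y" "\<lambda>_. count_space UNIV"
    by (rule Ionescu_Tulcea_walk)
  show ?thesis
    unfolding quenched_law_def by (rule IT.PF.sets_lim)
qed

lemma space_quenched_law [simp]: "space (quenched_law w y) = UNIV"
  using sets_eq_imp_space_eq[OF sets_quenched_law[of w y]] by (simp add: space_PiM)

text \<open>For an initial segment of times the marginal is the iterated kernel itself, because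
  \<open>up_to {0..<m}\<close> is \<open>m\<close>; integrals over paths thereby become integrals
  over \<open>m\<close> successive kernels.\<close>

lemma nn_integral_quenched_restrict:
  fixes h :: "(nat \<Rightarrow> vertex) \<Rightarrow> ennreal"
  assumes [measurable]: "h \<in> borel_measurable (\<Pi>\<^sub>M k\<in>{0..<m}. count_space UNIV)"
  shows "(\<integral>\<^sup>+X. h (restrict X {0..<m}) \<partial>quenched_law w y)
    = (\<integral>\<^sup>+X. h X \<partial>Ionescu_Tulcea.C (walk_kernel w y) (\<lambda>_. count_space UNIV) 0 m (\<lambda>_. undefined))"
proof -
  interpret IT: Ionescu_Tulcea "walk_kernel w y" "\<lambda>_. count_space UNIV"
    by (rule Ionescu_Tulcea_walk)
  let ?M = "\<lambda>_::nat. count_space (UNIV :: vertex set)"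
  have up: "IT.up_to {0..<m} = m"
    using IT.up_to_less[of "{0..<m}" "IT.up_to {0..<m}"] by (force simp: IT.up_to_iff intro: antisym)
  have sC: "sets (IT.C 0 m (\<lambda>_. undefined)) = sets (PiM {0..<m} ?M)"
    using IT.sets_C[of "\<lambda>_. undefined" 0 m] by simp
  have "(\<integral>\<^sup>+X. h (restrict X {0..<m}) \<partial>IT.PF.lim)
      = (\<integral>\<^sup>+X. h X \<partial>distr IT.PF.lim (PiM {0..<m} ?M) (\<lambda>x. restrict x {0..<m}))"
    by (subst nn_integral_distr) (auto intro!: measurable_restrict simp: measurable_cong_sets[OF IT.PF.sets_lim refl])
  also have "\<dots> = (\<integral>\<^sup>+X. h X \<partial>IT.CI {0..<m})"
    by (subst IT.distr_lim) auto
  also have "\<dots> = (\<integral>\<^sup>+X. h (restrict X {0..<m}) \<partial>IT.C 0 m (\<lambda>_. undefined))"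
    unfolding IT.CI_def up
    by (subst nn_integral_distr) (auto intro!: measurable_restrict simp: measurable_cong_sets[OF sC refl])
  also have "\<dots> = (\<integral>\<^sup>+X. h X \<partial>IT.C 0 m (\<lambda>_. undefined))"
    using sets_eq_imp_space_eq[OF sC]
    by (intro nn_integral_cong) (auto simp: space_PiM PiE_restrict)
  finally show ?thesis
    by (simp add: quenched_law_def)
qed

text \<open>Markov property at time \<open>n\<close> in integrated form: the law up to time
  \<open>Suc n\<close> is the law up to time \<open>n\<close> followed by one kernel, and
  \<open>F\<close>, which reads only \<open>X 0\<close> to \<open>X n\<close>, leaves the inner
  integral.\<close>

lemma nn_integral_quenched_step:
  fixes F :: "(nat \<Rightarrow> vertex) \<Rightarrow> ennreal" and f :: "vertex \<Rightarrow> ennreal"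
  assumes F[measurable]: "F \<in> borel_measurable (\<Pi>\<^sub>M k\<in>{0..<Suc n}. count_space UNIV)"
  shows "(\<integral>\<^sup>+X. F (restrict X {0..<Suc n}) * f (X (Suc n)) \<partial>quenched_law w y)
    = (\<integral>\<^sup>+X. F (restrict X {0..<Suc n}) * (\<integral>\<^sup>+z. f z \<partial>measure_pmf (step w (X n))) \<partial>quenched_law w y)"
proof -
  interpret IT: Ionescu_Tulcea "walk_kernel w y" "\<lambda>_. count_space UNIV"
    by (rule Ionescu_Tulcea_walk)
  let ?M = "\<lambda>_::nat. count_space (UNIV :: vertex set)"
  let ?C = "\<lambda>m. IT.C 0 m (\<lambda>_. undefined)"
  have sC: "sets (?C m) = sets (PiM {0..<m} ?M)" for m
    using IT.sets_C[of "\<lambda>_. undefined" 0 m] by simp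
  have [measurable]: "(\<lambda>X. X k) \<in> PiM {0..<m} ?M \<rightarrow>\<^sub>M count_space UNIV" if "k < m" for k m
    using that by (intro measurable_component_singleton) auto
  have [measurable]: "(\<lambda>X. f (X k)) \<in> borel_measurable (PiM {0..<m} ?M)" if "k < m" for k m and f :: "vertex \<Rightarrow> ennreal"
    by (rule measurable_compose[of "\<lambda>X. X k" _ "count_space UNIV"]) (use that in \<open>auto intro!: measurable_component_singleton\<close>)
  have [measurable]: "(\<lambda>X. restrict X {0..<Suc n}) \<in> PiM {0..<m} ?M \<rightarrow>\<^sub>M PiM {0..<Suc n} ?M" if "Suc n \<le> m" for m
    using that by (intro measurable_restrict) auto
  have "(\<integral>\<^sup>+X. F (restrict X {0..<Suc n}) * f (X (Suc n)) \<partial>quenched_law w y)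
      = (\<integral>\<^sup>+X. F (restrict (restrict X {0..<Suc (Suc n)}) {0..<Suc n}) * f (restrict X {0..<Suc (Suc n)} (Suc n)) \<partial>quenched_law w y)"
    by (intro nn_integral_cong) (auto simp: Int_absorb1 Int_absorb2 Int_commute)
  also have "\<dots> = (\<integral>\<^sup>+X. F (restrict X {0..<Suc n}) * f (X (Suc n)) \<partial>?C (Suc (Suc n)))"
    by (rule nn_integral_quenched_restrict) measurable
  also have "\<dots> = (\<integral>\<^sup>+X. (\<integral>\<^sup>+X'. F (restrict X' {0..<Suc n}) * f (X' (Suc n)) \<partial>IT.eP (Suc n) X) \<partial>?C (Suc n))"
  proof -
    have e: "?C (Suc (Suc n)) = ?C (Suc n) \<bind> IT.eP (Suc n)" by simp
    show ?thesis unfolding e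
      using IT.measurable_eP[of "Suc n"]
      by (subst nn_integral_bind[where B="PiM {0..<Suc (Suc n)} ?M"])
         (measurable, simp_all add: measurable_cong_sets[OF sC refl])
  qed
  also have "\<dots> = (\<integral>\<^sup>+X. F (restrict X {0..<Suc n}) * (\<integral>\<^sup>+z. f z \<partial>measure_pmf (step w (X n))) \<partial>?C (Suc n))"
  proof (intro nn_integral_cong)
    fix X assume "X \<in> space (?C (Suc n))"
    then have X: "X \<in> space (PiM {0..<Suc n} ?M)"
      using sets_eq_imp_space_eq[OF sC[of "Suc n"]] by (simp del: IT.C.simps)
    then have r: "restrict (X(Suc n := z)) {0..<Suc n} = X" for z
      by (auto simp: space_PiM PiE_def extensional_def restrict_def fun_eq_iff)
    have "restrict X {0..<Suc n} = X"
      using X by (auto simp: space_PiM PiE_restrict)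
    then show "(\<integral>\<^sup>+X'. F (restrict X' {0..<Suc n}) * f (X' (Suc n)) \<partial>IT.eP (Suc n) X)
      = F (restrict X {0..<Suc n}) * (\<integral>\<^sup>+z. f z \<partial>measure_pmf (step w (X n)))"
      using X by (subst IT.nn_integral_eP) (simp_all add: r nn_integral_cmult walk_kernel_def)
  qed
  also have "\<dots> = (\<integral>\<^sup>+X. F (restrict (restrict X {0..<Suc n}) {0..<Suc n}) *
      (\<integral>\<^sup>+z. f z \<partial>measure_pmf (step w (restrict X {0..<Suc n} n))) \<partial>quenched_law w y)"
    by (rule nn_integral_quenched_restrict[symmetric]) measurable
  finally show ?thesis by simp
qed

text \<open>The initial vertex is drawn by the kernel of index 0, so paths starting elsewhere belong
  to the space and only form a null set.\<close>

lemma AE_quenched_start: "AE X in quenched_law w y. X 0 = y"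
proof -
  interpret IT: Ionescu_Tulcea "walk_kernel w y" "\<lambda>_. count_space UNIV"
    by (rule Ionescu_Tulcea_walk)
  interpret Q: prob_space "quenched_law w y" by (rule prob_space_quenched_law)
  let ?M = "\<lambda>_::nat. count_space (UNIV :: vertex set)"
  let ?f = "\<lambda>x. if x = y then 0 else 1 :: ennreal"
  have [measurable]: "(\<lambda>X. f (X 0)) \<in> borel_measurable (PiM {0..<Suc 0} ?M)" for f :: "vertex \<Rightarrow> ennreal"
    by (rule measurable_compose[of "\<lambda>X. X 0" _ "count_space UNIV"]) (auto intro!: measurable_component_singleton)
  have e: "IT.C 0 (Suc 0) (\<lambda>_. undefined) = IT.eP 0 (\<lambda>_. undefined)"
    using IT.measurable_eP[of 0]
    by (simp, subst bind_return[where N="PiM {0..<Suc 0} ?M"]) (auto simp: space_PiM)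
  have "(\<integral>\<^sup>+X. ?f (X 0) \<partial>quenched_law w y) = (\<integral>\<^sup>+X. ?f (restrict X {0..<Suc 0} 0) \<partial>quenched_law w y)"
    by (intro nn_integral_cong) auto
  also have "\<dots> = (\<integral>\<^sup>+X. ?f (X 0) \<partial>IT.C 0 (Suc 0) (\<lambda>_. undefined))"
    by (rule nn_integral_quenched_restrict) measurable
  also have "\<dots> = (\<integral>\<^sup>+z. ?f z \<partial>walk_kernel w y 0 (\<lambda>_. undefined))"
    unfolding e by (subst IT.nn_integral_eP) (auto simp: space_PiM)
  also have "\<dots> = 0" by (simp add: walk_kernel_def)
  finally have "(\<integral>\<^sup>+X. ?f (X 0) \<partial>quenched_law w y) = 0" .
  moreover have "(\<lambda>X. ?f (X 0)) \<in> borel_measurable (quenched_law w y)" by measurable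
  ultimately show ?thesis
    by (subst (asm) nn_integral_0_iff_AE) (auto elim!: eventually_mono split: if_splits)
qed

lemma AE_quenched_step: "AE X in quenched_law w y. X (Suc n) \<in> set_pmf (step w (X n))"
proof -
  interpret IT: Ionescu_Tulcea "walk_kernel w y" "\<lambda>_. count_space UNIV"
    by (rule Ionescu_Tulcea_walk)
  let ?M = "\<lambda>_::nat. count_space (UNIV :: vertex set)"
  let ?f = "\<lambda>x z. if z \<in> set_pmf (step w x) then 0 else 1 :: ennreal"
  \<comment> \<open>Fixing \<open>X n = x\<close> makes the forbidden set of next vertices constant,
    as the one-step formula demands; there are countably many \<open>x\<close>.\<close>
  have *: "AE X in quenched_law w y. X n = x \<longrightarrow> X (Suc n) \<in> set_pmf (step w (X n))" for x
  proof -
    let ?F = "\<lambda>X. if X n = x then 1 else 0 :: ennreal"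
    have [measurable]: "?F \<in> borel_measurable (PiM {0..<Suc n} ?M)"
      by (rule measurable_compose[of "\<lambda>X. X n" _ "count_space UNIV"]) (auto intro!: measurable_component_singleton)
    have "(\<integral>\<^sup>+X. ?F (restrict X {0..<Suc n}) * ?f x (X (Suc n)) \<partial>quenched_law w y)
      = (\<integral>\<^sup>+X. ?F (restrict X {0..<Suc n}) * (\<integral>\<^sup>+z. ?f x z \<partial>measure_pmf (step w (X n))) \<partial>quenched_law w y)"
      by (rule nn_integral_quenched_step) measurable
    also have "\<dots> = (\<integral>\<^sup>+X. 0 \<partial>quenched_law w y)"
    proof (intro nn_integral_cong)
      fix X :: "nat \<Rightarrow> vertex"
      have "(\<integral>\<^sup>+z. ?f x z \<partial>measure_pmf (step w x)) = 0"
        by (subst nn_integral_0_iff_AE) (auto simp: AE_measure_pmf_iff)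
      then show "?F (restrict X {0..<Suc n}) * (\<integral>\<^sup>+z. ?f x z \<partial>measure_pmf (step w (X n))) = 0"
        by (cases "X n = x") auto
    qed
    finally have "(\<integral>\<^sup>+X. (if X n = x then 1 else 0) * ?f x (X (Suc n)) \<partial>quenched_law w y) = 0" by simp
    moreover have "(\<lambda>X. (if X n = x then 1 else 0) * ?f x (X (Suc n))) \<in> borel_measurable (quenched_law w y)"
      by measurable
    ultimately show ?thesis
      by (subst (asm) nn_integral_0_iff_AE) (auto elim!: eventually_mono split: if_splits)
  qed
  have "AE X in quenched_law w y. \<forall>x. X n = x \<longrightarrow> X (Suc n) \<in> set_pmf (step w (X n))"
    using * by (subst AE_all_countable) auto
  then show ?thesis by auto
qed

text \<open>\<open>level_sum \<theta> n\<close> is \<open>Z\<^sub>n(\<theta>)\<close>, decomposed at the root.\<close>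

primrec level_sum :: "real \<Rightarrow> nat \<Rightarrow> env \<Rightarrow> real" where
  "level_sum \<theta> 0 w = 1"
| "level_sum \<theta> (Suc n) w =
    (\<Sum>j<num_children w []. omega w root (Some [j]) powr \<theta> * level_sum \<theta> n (\<lambda>x. w (j # x)))"

section \<open>Upward steps and the climb\<close>

lemma omega_root_child:
  "j < num_children w [] \<Longrightarrow>
    omega w root (Some [j]) = Aval w [j] / (1 + (\<Sum>l<num_children w []. Aval w [l]))"
  by (auto simp: parent_def)

text \<open>The environment seen from \<open>x\<close> is the shifted one. Only the parent differs,
  and it is never a child. This is what turns a climb from \<open>x\<close> into the recursion of
  \<open>level_sum\<close>.\<close>

lemma omega_child:
  assumes "j < num_children w x"
  shows "omega w (Some x) (Some (x @ [j])) = omega (\<lambda>y. w (x @ y)) root (Some [j])"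
proof -
  have "Some (x @ [j]) \<noteq> parent x"
    by (metis append_Nil2 append_butlast_last_id append_eq_appendI append_is_Nil_conv not_Cons_self2
        option.distinct(1) option.inject parent_def same_append_eq)
  with assms show ?thesis
    by (auto simp: parent_def num_children_def Aval_def)
qed

lemma omega_root_bounds:
  assumes pos: "\<And>x. Aval w x > 0" and j: "j < num_children w []"
  shows "0 < omega w root (Some [j])" "omega w root (Some [j]) < 1"
    "(\<Sum>j<num_children w []. omega w root (Some [j])) < 1"
proof -
  let ?S = "\<Sum>l<num_children w []. Aval w [l]"
  have S: "0 \<le> ?S" by (intro sum_nonneg less_imp_le pos)
  then have "1 + ?S > 0" by linarith
  then show p: "0 < omega w root (Some [j])"
    unfolding omega_root_child[OF j] using pos[of "[j]"] by (intro divide_pos_pos)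
  have "Aval w [j] \<le> ?S"
    using j pos by (intro member_le_sum) (auto intro: less_imp_le)
  then show "omega w root (Some [j]) < 1"
    unfolding omega_root_child[OF j] using S by simp
  have "(\<Sum>j<num_children w []. omega w root (Some [j])) = ?S / (1 + ?S)"
    unfolding sum_divide_distrib by (intro sum.cong refl omega_root_child) auto
  then show "(\<Sum>j<num_children w []. omega w root (Some [j])) < 1"
    using S by simp
qed

lemma level_sum_nonneg [simp]: "0 \<le> level_sum \<theta> n w"
  by (induction n arbitrary: w) (auto intro!: sum_nonneg)

lemma gen_step_le:
  assumes pos: "\<And>x. Aval w x > 0" and y: "y \<in> set_pmf (step w v)"
  shows "gen y \<le> gen v + 1"
proof -
  have "omega w v y \<noteq> 0"
    using y pmf_step[OF pos, of v y] by (simp add: set_pmf_eq)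
  then show ?thesis
    by (cases v) (auto simp: parent_def split: if_splits)
qed

lemma nn_integral_step_child:
  assumes pos: "\<And>x. Aval w x > 0"
  shows "(\<integral>\<^sup>+z. f z * indicator {z. gen z = int (Suc (length x))} z \<partial>measure_pmf (step w (Some x)))
    = (\<Sum>j<num_children w x. ennreal (omega w (Some x) (Some (x @ [j]))) * f (Some (x @ [j])))"
proof -
  let ?C = "(\<lambda>j. Some (x @ [j])) ` {..<num_children w x}"
  have "(\<integral>\<^sup>+z. f z * indicator {z. gen z = int (Suc (length x))} z \<partial>measure_pmf (step w (Some x)))
    = (\<integral>\<^sup>+z. ennreal (omega w (Some x) z) * (f z * indicator {z. gen z = int (Suc (length x))} z) \<partial>count_space UNIV)"
    by (simp add: nn_integral_measure_pmf pmf_step[OF pos])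
  also have "\<dots> = (\<Sum>z\<in>?C. ennreal (omega w (Some x) z) * (f z * indicator {z. gen z = int (Suc (length x))} z))"
    by (rule nn_integral_count_space') (auto simp: parent_def split: if_splits)
  also have "\<dots> = (\<Sum>j<num_children w x. ennreal (omega w (Some x) (Some (x @ [j]))) * f (Some (x @ [j])))"
    by (subst sum.reindex) (auto simp: inj_on_def simp del: omega.simps)
  finally show ?thesis .
qed

definition climb_event :: "nat \<Rightarrow> (nat \<Rightarrow> vertex) set" where
  "climb_event n = {X. \<forall>k\<le>n. gen (X k) = int k}"

lemma emeasure_climb_event:
  assumes pos: "\<And>x. Aval w x > 0"
  shows "emeasure (quenched_law w root) (climb_event n) = ennreal (level_sum 1 n w)"
proof -
  let ?Q = "quenched_law w root"
  interpret prob_space ?Q by (rule prob_space_quenched_law)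
  let ?M = "\<lambda>_::nat. count_space (UNIV :: vertex set)"
  \<comment> \<open>\<open>D m v\<close> stands for the probability of climbing \<open>m\<close>
    further generations from \<open>v\<close>, and \<open>F n\<close> records that the walk has
    climbed up to time \<open>n\<close>. The integral of \<open>F n X * D m (X n)\<close> depends
    only on \<open>n + m\<close>, which moves the computation to time 0.\<close>
  define D :: "nat \<Rightarrow> vertex \<Rightarrow> ennreal" where
    "D m v = (case v of None \<Rightarrow> 0 | Some x \<Rightarrow> ennreal (level_sum 1 m (\<lambda>y. w (x @ y))))" for m v
  define F :: "nat \<Rightarrow> (nat \<Rightarrow> vertex) \<Rightarrow> ennreal" where "F n = indicator (climb_event n)" for n
  have F_restrict: "F n (restrict X {0..<Suc n}) = F n X" for n X
    by (auto simp: F_def climb_event_def indicator_def)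
  have F_meas[measurable]: "F n \<in> borel_measurable (PiM {0..<Suc n} ?M)" for n
  proof -
    have [measurable]: "(\<lambda>X. gen (X k)) \<in> PiM {0..<Suc n} ?M \<rightarrow>\<^sub>M count_space UNIV" if "k \<le> n" for k
      by (rule measurable_compose[of "\<lambda>X. X k" _ "count_space UNIV"])
        (use that in \<open>auto intro!: measurable_component_singleton\<close>)
    have "F n = (\<lambda>X. \<Prod>k\<le>n. if gen (X k) = int k then 1 else 0)"
      by (auto simp: F_def climb_event_def indicator_def fun_eq_iff prod_zero_iff)
    also have "\<dots> \<in> borel_measurable (PiM {0..<Suc n} ?M)"
      by (intro borel_measurable_prod_ennreal measurable_If) (auto intro!: measurable_const)
    finally show ?thesis .
  qed
  have F_Suc: "F (Suc n) X = F n X * indicator {z. gen z = int (Suc n)} (X (Suc n))" for n X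
    by (auto simp: F_def climb_event_def indicator_def le_Suc_eq)
  have step: "(\<integral>\<^sup>+X. F (Suc n) X * D m (X (Suc n)) \<partial>?Q) = (\<integral>\<^sup>+X. F n X * D (Suc m) (X n) \<partial>?Q)" for n m
  proof -
    have "(\<integral>\<^sup>+X. F (Suc n) X * D m (X (Suc n)) \<partial>?Q)
      = (\<integral>\<^sup>+X. F n (restrict X {0..<Suc n}) * (D m (X (Suc n)) * indicator {z. gen z = int (Suc n)} (X (Suc n))) \<partial>?Q)"
      unfolding F_restrict F_Suc by (intro nn_integral_cong) (simp add: ac_simps)
    also have "\<dots> = (\<integral>\<^sup>+X. F n (restrict X {0..<Suc n})
        * (\<integral>\<^sup>+z. D m z * indicator {z. gen z = int (Suc n)} z \<partial>measure_pmf (step w (X n))) \<partial>?Q)"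
      by (rule nn_integral_quenched_step) measurable
    also have "\<dots> = (\<integral>\<^sup>+X. F n X * D (Suc m) (X n) \<partial>?Q)"
    proof (intro nn_integral_cong)
      fix X :: "nat \<Rightarrow> vertex"
      show "F n (restrict X {0..<Suc n})
          * (\<integral>\<^sup>+z. D m z * indicator {z. gen z = int (Suc n)} z \<partial>measure_pmf (step w (X n)))
        = F n X * D (Suc m) (X n)"
      proof (cases "gen (X n) = int n")
        case False
        then have "F n X = 0" by (auto simp: F_def climb_event_def indicator_def)
        then show ?thesis unfolding F_restrict by simp
      next
        case True
        then obtain x where x: "X n = Some x" "length x = n" by (cases "X n") auto
        have "(\<integral>\<^sup>+z. D m z * indicator {z. gen z = int (Suc n)} z \<partial>measure_pmf (step w (X n)))
          = (\<Sum>j<num_children w x. ennreal (omega w (Some x) (Some (x @ [j]))) * D m (Some (x @ [j])))"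
          using nn_integral_step_child[OF pos, where f="D m" and x=x] by (simp only: x)
        also have "\<dots> = (\<Sum>j<num_children (\<lambda>y. w (x @ y)) []. ennreal (omega (\<lambda>y. w (x @ y)) root (Some [j]) powr 1
             * level_sum 1 m (\<lambda>y. w (x @ j # y))))"
        proof (rule sum.cong)
          fix j assume j: "j \<in> {..<num_children (\<lambda>y. w (x @ y)) []}"
          then have j': "j < num_children w x" by (simp add: num_children_def)
          have "0 < omega (\<lambda>y. w (x @ y)) root (Some [j])"
            using j pos by (intro omega_root_bounds) (auto simp: Aval_def)
          then show "ennreal (omega w (Some x) (Some (x @ [j]))) * D m (Some (x @ [j]))
            = ennreal (omega (\<lambda>y. w (x @ y)) root (Some [j]) powr 1 * level_sum 1 m (\<lambda>y. w (x @ j # y)))"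
            unfolding omega_child[OF j'] by (simp add: D_def ennreal_mult' del: omega.simps)
        qed (simp add: num_children_def)
        also have "\<dots> = D (Suc m) (X n)"
          unfolding x(1) D_def by (simp add: sum_ennreal del: omega.simps)
        finally show ?thesis unfolding F_restrict by simp
      qed
    qed
    finally show ?thesis .
  qed
  have climb: "(\<integral>\<^sup>+X. F n X * D m (X n) \<partial>?Q) = (\<integral>\<^sup>+X. F 0 X * D (n + m) (X 0) \<partial>?Q)" for m
    by (induction n arbitrary: m) (simp_all add: step)
  have [measurable]: "F n \<in> borel_measurable ?Q" for n
  proof -
    have "F n = (\<lambda>X. F n (restrict X {0..<Suc n}))" by (simp add: F_restrict)
    also have "\<dots> \<in> borel_measurable ?Q"
      by (rule measurable_compose[OF _ F_meas]) (auto intro!: measurable_restrict simp: measurable_cong_sets[OF sets_quenched_law refl])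
    finally show ?thesis .
  qed
  have "climb_event n = F n -` {1} \<inter> space ?Q"
    by (auto simp: F_def indicator_def)
  also have "\<dots> \<in> sets ?Q" by measurable
  finally have "emeasure ?Q (climb_event n) = (\<integral>\<^sup>+X. F n X \<partial>?Q)"
    by (simp add: F_def)
  also have "\<dots> = (\<integral>\<^sup>+X. F n X * D 0 (X n) \<partial>?Q)"
  proof (intro nn_integral_cong)
    fix X show "F n X = F n X * D 0 (X n)"
      by (cases "X n") (auto simp: F_def D_def climb_event_def indicator_def)
  qed
  also have "\<dots> = (\<integral>\<^sup>+X. F 0 X * D n (X 0) \<partial>?Q)" using climb[of 0] by simp
  also have "\<dots> = (\<integral>\<^sup>+X. ennreal (level_sum 1 n w) \<partial>?Q)"
  proof (rule nn_integral_cong_AE)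
    show "AE X in ?Q. F 0 X * D n (X 0) = ennreal (level_sum 1 n w)"
      using AE_quenched_start[where w=w and y=root]
      by eventually_elim (simp add: F_def D_def climb_event_def)
  qed
  also have "\<dots> = ennreal (level_sum 1 n w)" using emeasure_space_1 by simp
  finally show ?thesis .
qed

lemma AE_quenched_path:
  assumes pos: "\<And>x. Aval w x > 0"
  shows "AE X in quenched_law w root. X 0 = root \<and> (\<forall>n. gen (X (Suc n)) \<le> gen (X n) + 1)"
proof -
  have "AE X in quenched_law w root. \<forall>n. X (Suc n) \<in> set_pmf (step w (X n))"
    by (subst AE_all_countable) (simp add: AE_quenched_step)
  with AE_quenched_start[where w=w and y=root] show ?thesis
    by eventually_elim (auto intro: gen_step_le[OF pos])
qed

lemma gen_diff_le:
  assumes "\<And>n. gen (X (Suc n)) \<le> gen (X n) + 1"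
  shows "gen (X (k + m)) \<le> gen (X k) + int m"
proof (induction m)
  case (Suc m)
  then show ?case using assms[of "k + m"] by simp
qed simp

lemma measurable_hit_event [measurable]: "hit_event n a b \<in> sets (quenched_law w y)"
proof -
  have [measurable]: "(\<lambda>X. gen (X k)) \<in> quenched_law w y \<rightarrow>\<^sub>M count_space UNIV" for k
    by (rule measurable_compose[of "\<lambda>X. X k" _ "count_space UNIV"])
      (auto intro!: measurable_component_singleton simp: measurable_cong_sets[OF sets_quenched_law refl])
  \<comment> \<open>An infimum over a set that depends on the path becomes a countable infimum of
    measurable functions, with value \<open>\<infinity>\<close> at times off generation
    \<open>n\<close>.\<close>
  have "hitting_time n X = (INF k. if gen (X k) = int n then ereal (real k) else \<infinity>)" for X
    unfolding hitting_time_def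
  proof (rule antisym)
    show "(INF k\<in>{k. gen (X k) = int n}. ereal (real k)) \<le> (INF k. if gen (X k) = int n then ereal (real k) else \<infinity>)"
      by (rule INF_greatest) (auto intro: INF_lower)
    have "(INF k. if gen (X k) = int n then ereal (real k) else \<infinity>) \<le> ereal (real k)" if "gen (X k) = int n" for k
      using INF_lower[of k UNIV "\<lambda>k. if gen (X k) = int n then ereal (real k) else \<infinity>"] that by simp
    then show "(INF k. if gen (X k) = int n then ereal (real k) else \<infinity>) \<le> (INF k\<in>{k. gen (X k) = int n}. ereal (real k))"
      by (intro INF_greatest) auto
  qed
  moreover have "(\<lambda>X. INF k. if gen (X k) = int n then ereal (real k) else \<infinity>)
      \<in> borel_measurable (quenched_law w y)"
    by measurable
  ultimately have "(\<lambda>X. hitting_time n X) \<in> borel_measurable (quenched_law w y)"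
    by presburger
  then have "hitting_time n -` {z. z / ereal (real n) \<in> {ereal a<..ereal b}} \<inter> space (quenched_law w y) \<in> sets (quenched_law w y)"
    by measurable
  then show ?thesis by (simp add: hit_event_def vimage_def)
qed

text \<open>Generations rise by at most one per step. Counted from time 0 this gives
  \<open>gen (X k) \<le> int k\<close>, so \<open>n\<close> is the earliest possible hitting time;
  counted back from time \<open>n\<close> it gives the reverse inequality at all earlier
  times.\<close>

lemma hit_event_iff_climb_event:
  assumes n: "0 < n" and X0: "X 0 = root" and step: "\<And>n. gen (X (Suc n)) \<le> gen (X n) + 1"
  shows "X \<in> hit_event n 0 1 \<longleftrightarrow> X \<in> climb_event n"
proof
  have le: "gen (X k) \<le> int k" for k
    using gen_diff_le[of X 0 k, OF step] X0 by simp
  show "X \<in> climb_event n" if "X \<in> hit_event n 0 1"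
  proof -
    have "hitting_time n X / ereal (real n) \<le> ereal 1" using that by (simp add: hit_event_def)
    then have "hitting_time n X \<le> ereal (real n)"
      using n by (cases "hitting_time n X") (auto simp: field_simps)
    \<comment> \<open>A strict bound is needed to extract a time from the infimum; integrality turns
      \<open>k < n + 1\<close> into \<open>k \<le> n\<close>.\<close>
    then have "hitting_time n X < ereal (real n + 1)"
      by (rule order.strict_trans1) simp
    then obtain k where k: "gen (X k) = int n" "real k < real n + 1"
      unfolding hitting_time_def by (auto simp: INF_less_iff)
    with le[of k] have "k = n" by auto
    have "gen (X j) = int j" if "j \<le> n" for j
      using gen_diff_le[of X j "n - j", OF step] le[of j] k \<open>k = n\<close> that by auto
    then show ?thesis by (simp add: climb_event_def)
  qed
  show "X \<in> hit_event n 0 1" if "X \<in> climb_event n"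
  proof -
    have "hitting_time n X = ereal (real n)"
      unfolding hitting_time_def
    proof (rule antisym)
      show "(INF k\<in>{k. gen (X k) = int n}. ereal (real k)) \<le> ereal (real n)"
        using that by (intro INF_lower) (auto simp: climb_event_def)
      show "ereal (real n) \<le> (INF k\<in>{k. gen (X k) = int n}. ereal (real k))"
        using le by (intro INF_greatest) (simp, metis of_nat_le_iff)
    qed
    then show ?thesis using n by (simp add: hit_event_def zero_ereal_def one_ereal_def)
  qed
qed

lemma measure_hit_event:
  assumes pos: "\<And>x. Aval w x > 0" and n: "0 < n"
  shows "measure (quenched_law w root) (hit_event n 0 1) = level_sum 1 n w"
proof -
  let ?Q = "quenched_law w root"
  interpret prob_space ?Q by (rule prob_space_quenched_law)
  have [measurable]: "(\<lambda>X. gen (X k)) \<in> ?Q \<rightarrow>\<^sub>M count_space UNIV" for k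
    by (rule measurable_compose[of "\<lambda>X. X k" _ "count_space UNIV"])
      (auto intro!: measurable_component_singleton simp: measurable_cong_sets[OF sets_quenched_law refl])
  have "{X \<in> space ?Q. \<forall>k\<le>n. gen (X k) = int k} \<in> sets ?Q" by measurable
  then have [measurable]: "climb_event n \<in> sets ?Q" by (simp add: climb_event_def)
  have "measure ?Q (hit_event n 0 1) = measure ?Q (climb_event n)"
  proof (rule finite_measure_eq_AE)
    show "AE X in ?Q. X \<in> hit_event n 0 1 \<longleftrightarrow> X \<in> climb_event n"
      using AE_quenched_path[OF pos] by eventually_elim (use hit_event_iff_climb_event[OF n] in blast)
  qed measurable
  also have "\<dots> = level_sum 1 n w"
    using emeasure_climb_event[OF pos] by (simp add: measure_def)
  finally show ?thesis .
qed

section \<open>Independence in the environment\<close>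

lemma borel_measurable_random_sum [measurable (raw)]:
  fixes f :: "nat \<Rightarrow> 'a \<Rightarrow> 'b::{second_countable_topology, topological_comm_monoid_add}"
  assumes [measurable]: "N \<in> M \<rightarrow>\<^sub>M count_space UNIV" "\<And>j. f j \<in> borel_measurable M"
  shows "(\<lambda>x. \<Sum>j<N x. f j x) \<in> borel_measurable M"
  by (rule measurable_compose_countable[where g = N and f = "\<lambda>n x. \<Sum>j<n. f j x"]) measurable

text \<open>The pair at a word is split into two real coordinates because its entries act at
  different places: the label A of a child enters the weights at its parent, while its number of
  children belongs to its own subtree.\<close>

primrec coordinate :: "env \<Rightarrow> nat list + nat list \<Rightarrow> real" where
  "coordinate w (Inl x) = real (num_children w x)"
| "coordinate w (Inr x) = Aval w x"

text \<open>Rebuilds an environment from the coordinates in \<open>B\<close>. The filler 1 and the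
  test \<open>0 < u (Inr x)\<close> keep all labels positive, so every real family yields a point of
  the environment space.\<close>

definition decode :: "(nat list + nat list) set \<Rightarrow> (nat list + nat list \<Rightarrow> real) \<Rightarrow> env" where
  "decode B u x = (if Inl x \<in> B then nat \<lfloor>u (Inl x)\<rfloor> else 0,
     if Inr x \<in> B \<and> 0 < u (Inr x) then u (Inr x) else 1)"

definition project :: "(nat list + nat list) set \<Rightarrow> env \<Rightarrow> env" where
  "project B w x = (if Inl x \<in> B then fst (w x) else 0, if Inr x \<in> B then snd (w x) else 1)"

lemma decode_coordinate:
  assumes "\<And>x. Aval w x > 0"
  shows "decode B (restrict (coordinate w) B) = project B w"
proof
  fix x show "decode B (restrict (coordinate w) B) x = project B w x"
    using assms[of x] by (auto simp: decode_def project_def num_children_def Aval_def)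
qed

locale gw_environment =
  fixes q :: "nat pmf" and \<mu> :: "real measure"
  assumes law: "positive_law \<mu>"
    and no_leaf: "pmf q 0 = 0"
    and finite_mean: "integrable (measure_pmf q) real"
begin

abbreviation "E \<equiv> environment_law q \<mu>"

lemma prob_space_mu: "prob_space \<mu>" and sets_mu: "sets \<mu> = sets (restrict_space borel {0<..})"
  using law by (auto simp: positive_law_def)

lemma space_mu: "space \<mu> = {0<..}"
  using sets_eq_imp_space_eq[OF sets_mu] by (simp add: space_restrict_space)

sublocale mu: prob_space \<mu> by (rule prob_space_mu)

lemma prob_space_qmu: "prob_space (measure_pmf q \<Otimes>\<^sub>M \<mu>)"
  by (intro prob_space_pair measure_pmf.prob_space_axioms prob_space_mu)

sublocale prob_space E
  unfolding environment_law_def by (rule prob_space_PiM) (rule prob_space_qmu)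

lemma sets_E [measurable_cong]: "sets E = sets (\<Pi>\<^sub>M x\<in>UNIV. measure_pmf q \<Otimes>\<^sub>M \<mu>)"
  by (simp add: environment_law_def)

lemma space_E: "space E = {w. \<forall>x. Aval w x > 0}"
  by (auto simp: environment_law_def space_PiM space_pair_measure space_mu Aval_def PiE_iff mem_Times_iff)

lemma measurable_E_component [measurable]: "(\<lambda>w. w x) \<in> E \<rightarrow>\<^sub>M (measure_pmf q \<Otimes>\<^sub>M \<mu>)"
  unfolding environment_law_def by (rule measurable_component_singleton) simp

lemma measurable_num_children [measurable]: "(\<lambda>w. num_children w x) \<in> E \<rightarrow>\<^sub>M count_space UNIV"
proof -
  have "(\<lambda>w. fst (w x)) \<in> E \<rightarrow>\<^sub>M measure_pmf q" by measurable
  then show ?thesis by (simp add: num_children_def)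
qed

lemma measurable_Aval [measurable]: "(\<lambda>w. Aval w x) \<in> borel_measurable E"
proof -
  have "(\<lambda>w. snd (w x)) \<in> E \<rightarrow>\<^sub>M \<mu>" by measurable
  also have "E \<rightarrow>\<^sub>M \<mu> = E \<rightarrow>\<^sub>M restrict_space borel {0<..}"
    by (rule measurable_cong_sets[OF refl sets_mu])
  finally show ?thesis
    by (simp add: Aval_def measurable_restrict_space2_iff)
qed

lemma measurable_coordinate [measurable]: "(\<lambda>w. coordinate w i) \<in> borel_measurable E"
  by (cases i) simp_all

lemma measurable_into_E:
  assumes "\<And>x. (\<lambda>v. fst (f v x)) \<in> M \<rightarrow>\<^sub>M count_space UNIV"
    and "\<And>x. (\<lambda>v. snd (f v x)) \<in> borel_measurable M" and "\<And>v x. snd (f v x) > 0"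
  shows "f \<in> M \<rightarrow>\<^sub>M E"
proof -
  have "(\<lambda>v x. f v x) \<in> M \<rightarrow>\<^sub>M (\<Pi>\<^sub>M x\<in>UNIV. measure_pmf q \<Otimes>\<^sub>M \<mu>)"
  proof (rule measurable_PiM_single')
    fix x :: "nat list"
    have "(\<lambda>v. snd (f v x)) \<in> M \<rightarrow>\<^sub>M restrict_space borel {0<..}"
      using assms by (intro measurable_restrict_space2) auto
    then have "(\<lambda>v. snd (f v x)) \<in> M \<rightarrow>\<^sub>M \<mu>"
      by (subst measurable_cong_sets[OF refl sets_mu])
    moreover have "(\<lambda>v. fst (f v x)) \<in> M \<rightarrow>\<^sub>M measure_pmf q"
      using assms(1) by simp
    ultimately have "(\<lambda>v. (fst (f v x), snd (f v x))) \<in> M \<rightarrow>\<^sub>M (measure_pmf q \<Otimes>\<^sub>M \<mu>)"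
      by (intro measurable_Pair)
    then show "(\<lambda>v. f v x) \<in> M \<rightarrow>\<^sub>M (measure_pmf q \<Otimes>\<^sub>M \<mu>)" by simp
  next
    show "(\<lambda>v x. f v x) \<in> space M \<rightarrow> (\<Pi>\<^sub>E x\<in>UNIV. space (measure_pmf q \<Otimes>\<^sub>M \<mu>))"
      using assms(3) by (auto simp: space_pair_measure space_mu mem_Times_iff)
  qed
  then show ?thesis by (simp add: environment_law_def)
qed

lemma prob_box:
  assumes "finite N" and V: "\<And>x. x \<in> N \<Longrightarrow> V x \<in> sets \<mu>"
  shows "prob {w \<in> space E. \<forall>x\<in>N. fst (w x) \<in> U x \<and> snd (w x) \<in> V x}
    = (\<Prod>x\<in>N. measure (measure_pmf q) (U x) * measure \<mu> (V x))"
proof -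
  have "{w \<in> space E. \<forall>x\<in>N. fst (w x) \<in> U x \<and> snd (w x) \<in> V x}
      = prod_emb UNIV (\<lambda>_. measure_pmf q \<Otimes>\<^sub>M \<mu>) N (\<Pi>\<^sub>E x\<in>N. U x \<times> V x)"
    by (auto simp: prod_emb_def environment_law_def space_PiM mem_Times_iff PiE_iff)
  then have "emeasure E {w \<in> space E. \<forall>x\<in>N. fst (w x) \<in> U x \<and> snd (w x) \<in> V x}
      = (\<Prod>x\<in>N. emeasure (measure_pmf q \<Otimes>\<^sub>M \<mu>) (U x \<times> V x))"
    unfolding environment_law_def using assms
    by (subst emeasure_PiM_emb[symmetric]) (auto simp: prob_space_qmu)
  also have "\<dots> = (\<Prod>x\<in>N. ennreal (measure (measure_pmf q) (U x) * measure \<mu> (V x)))"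
    using V by (intro prod.cong refl)
      (simp add: mu.emeasure_pair_measure_Times measure_pmf.emeasure_eq_measure mu.emeasure_eq_measure ennreal_mult'')
  also have "\<dots> = ennreal (\<Prod>x\<in>N. measure (measure_pmf q) (U x) * measure \<mu> (V x))"
    by (rule prod_ennreal) simp
  finally show ?thesis
    by (simp add: emeasure_eq_measure prod_nonneg)
qed

text \<open>Independence across words comes from the infinite product, independence of the two
  entries at one word from the pair measure. The constraints are therefore grouped by word into
  boxes.\<close>

lemma indep_coordinates: "indep_vars (\<lambda>_. borel) (\<lambda>i w. coordinate w i) UNIV"
  unfolding indep_vars_def2
proof (intro conjI ballI indep_setsI)
  fix A :: "nat list + nat list \<Rightarrow> env set" and J :: "(nat list + nat list) set"
  assume J: "finite J" and A: "\<forall>j\<in>J. A j \<in> {(\<lambda>w. coordinate w j) -` B \<inter> space E |B. B \<in> sets borel}"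
    and ne: "J \<noteq> {}"
  have "\<forall>j\<in>J. \<exists>B. B \<in> sets borel \<and> A j = (\<lambda>w. coordinate w j) -` B \<inter> space E"
    using A by blast
  then obtain B where B: "\<And>j. j \<in> J \<Longrightarrow> B j \<in> sets (borel :: real measure)"
      "\<And>j. j \<in> J \<Longrightarrow> A j = (\<lambda>w. coordinate w j) -` B j \<inter> space E"
    by metis
  \<comment> \<open>The constraints at \<open>x\<close> imposed by the indices in \<open>K\<close>;
    where there is none, the factor is the whole space and has mass 1. With \<open>K\<close> as a
    parameter, one product formula serves both \<open>J\<close> and its singletons.\<close>
  define U where "U K x = (if Inl x \<in> K then {k. real k \<in> B (Inl x)} else UNIV)" for K :: "(nat list + nat list) set" and x
  define V where "V K x = (if Inr x \<in> K then B (Inr x) \<inter> {0<..} else {0<..})" for K :: "(nat list + nat list) set" and x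
  define N where "N = Inl -` J \<union> Inr -` J"
  have N: "finite N" unfolding N_def using J by (intro finite_UnI finite_vimageI) auto
  have V: "V K x \<in> sets \<mu>" if "K \<subseteq> J" for K x
    using B that unfolding V_def sets_mu by (auto simp: sets_restrict_space_iff)
  have inter: "(\<Inter>j\<in>K. A j) = {w \<in> space E. \<forall>x\<in>N. fst (w x) \<in> U K x \<and> snd (w x) \<in> V K x}"
    if K: "K \<subseteq> J" "K \<noteq> {}" for K
  proof -
    have "w \<in> (\<Inter>j\<in>K. A j) \<longleftrightarrow> w \<in> space E \<and> (\<forall>j\<in>K. coordinate w j \<in> B j)" for w
      using B(2) K by (auto simp: subset_iff)
    moreover have "(\<forall>j\<in>K. coordinate w j \<in> B j) \<longleftrightarrow> (\<forall>x\<in>N. fst (w x) \<in> U K x \<and> snd (w x) \<in> V K x)"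
      if w: "w \<in> space E" for w
    proof -
      have p: "snd (w x) > 0" for x using w by (auto simp: space_E Aval_def)
      have "(\<forall>j\<in>K. coordinate w j \<in> B j) \<longleftrightarrow>
          (\<forall>x. (Inl x \<in> K \<longrightarrow> real (fst (w x)) \<in> B (Inl x)) \<and> (Inr x \<in> K \<longrightarrow> snd (w x) \<in> B (Inr x)))"
        by (metis coordinate.simps num_children_def Aval_def sum.exhaust)
      also have "\<dots> \<longleftrightarrow> (\<forall>x\<in>N. (Inl x \<in> K \<longrightarrow> real (fst (w x)) \<in> B (Inl x)) \<and> (Inr x \<in> K \<longrightarrow> snd (w x) \<in> B (Inr x)))"
        using K unfolding N_def by blast
      also have "\<dots> \<longleftrightarrow> (\<forall>x\<in>N. fst (w x) \<in> U K x \<and> snd (w x) \<in> V K x)"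
        using p by (auto simp: U_def V_def)
      finally show ?thesis .
    qed
    ultimately show ?thesis by blast
  qed
  have P: "prob (\<Inter>j\<in>K. A j) = (\<Prod>x\<in>N. measure (measure_pmf q) (U K x)) * (\<Prod>x\<in>N. measure \<mu> (V K x))"
    if K: "K \<subseteq> J" "K \<noteq> {}" for K
    unfolding inter[OF K] using prob_box[OF N V] K by (simp add: prod.distrib)
  have mu1: "measure \<mu> {0<..} = 1" using mu.prob_space space_mu by simp
  have Pl: "prob (A (Inl x)) = measure (measure_pmf q) (U J x)" if "Inl x \<in> J" for x
  proof -
    have "x \<in> N" using that by (simp add: N_def)
    have "prob (A (Inl x)) = (\<Prod>y\<in>N. measure (measure_pmf q) (U {Inl x} y)) * (\<Prod>y\<in>N. measure \<mu> (V {Inl x} y))"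
      using P[of "{Inl x}"] that by simp
    also have "(\<Prod>y\<in>N. measure \<mu> (V {Inl x} y)) = 1"
      by (simp add: V_def mu1)
    also have "(\<Prod>y\<in>N. measure (measure_pmf q) (U {Inl x} y)) = (\<Prod>y\<in>{x}. measure (measure_pmf q) (U {Inl x} y))"
      using N \<open>x \<in> N\<close> by (intro prod.mono_neutral_right) (auto simp: U_def)
    finally show ?thesis using that by (simp add: U_def)
  qed
  have Pr: "prob (A (Inr x)) = measure \<mu> (V J x)" if "Inr x \<in> J" for x
  proof -
    have "x \<in> N" using that by (simp add: N_def)
    have "prob (A (Inr x)) = (\<Prod>y\<in>N. measure (measure_pmf q) (U {Inr x} y)) * (\<Prod>y\<in>N. measure \<mu> (V {Inr x} y))"
      using P[of "{Inr x}"] that by simp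
    also have "(\<Prod>y\<in>N. measure (measure_pmf q) (U {Inr x} y)) = 1"
      by (simp add: U_def)
    also have "(\<Prod>y\<in>N. measure \<mu> (V {Inr x} y)) = (\<Prod>y\<in>{x}. measure \<mu> (V {Inr x} y))"
      using N \<open>x \<in> N\<close> by (intro prod.mono_neutral_right) (auto simp: V_def mu1)
    finally show ?thesis using that by (simp add: V_def)
  qed
  have JJ: "J = Inl ` (Inl -` J) \<union> Inr ` (Inr -` J)"
    by (auto simp: image_iff) (metis sum.exhaust)
  have "(\<Prod>j\<in>J. prob (A j)) = (\<Prod>j\<in>Inl ` (Inl -` J). prob (A j)) * (\<Prod>j\<in>Inr ` (Inr -` J). prob (A j))"
    by (subst (1) JJ, rule prod.union_disjoint) (use J in \<open>auto intro!: finite_imageI finite_vimageI\<close>)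
  also have "\<dots> = (\<Prod>x\<in>Inl -` J. measure (measure_pmf q) (U J x)) * (\<Prod>x\<in>Inr -` J. measure \<mu> (V J x))"
    by (simp add: prod.reindex Pl Pr del: image_vimage_eq)
  also have "(\<Prod>x\<in>Inl -` J. measure (measure_pmf q) (U J x)) = (\<Prod>x\<in>N. measure (measure_pmf q) (U J x))"
    using N by (intro prod.mono_neutral_left) (auto simp: U_def N_def)
  also have "(\<Prod>x\<in>Inr -` J. measure \<mu> (V J x)) = (\<Prod>x\<in>N. measure \<mu> (V J x))"
    using N by (intro prod.mono_neutral_left) (auto simp: V_def N_def mu1)
  finally show "prob (\<Inter>j\<in>J. A j) = (\<Prod>j\<in>J. prob (A j))"
    using P[OF order_refl ne] by simp
qed auto

lemma measurable_decode: "decode B \<in> PiM B (\<lambda>_. borel) \<rightarrow>\<^sub>M E"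
proof (rule measurable_into_E)
  fix x
  have c: "(\<lambda>u. u i) \<in> borel_measurable (PiM B (\<lambda>_. borel :: real measure))" if "i \<in> B" for i
    by (rule measurable_component_singleton[OF that])
  show "(\<lambda>u. fst (decode B u x)) \<in> PiM B (\<lambda>_. borel) \<rightarrow>\<^sub>M count_space UNIV"
    using c[of "Inl x"] by (cases "Inl x \<in> B") (simp_all add: decode_def)
  show "(\<lambda>u. snd (decode B u x)) \<in> borel_measurable (PiM B (\<lambda>_. borel))"
    using c[of "Inr x"] by (cases "Inr x \<in> B") (simp_all add: decode_def)
qed (simp add: decode_def)

text \<open>A function that factors through \<open>project B\<close> depends only on the labels listed in \<open>B\<close>.\<close>

lemma nn_integral_indep_mult:
  fixes F G :: "env \<Rightarrow> ennreal"
  assumes [measurable]: "F \<in> borel_measurable E" "G \<in> borel_measurable E"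
    and F: "\<And>w. w \<in> space E \<Longrightarrow> F (project B w) = F w"
    and G: "\<And>w. w \<in> space E \<Longrightarrow> G (project (- B) w) = G w"
  shows "(\<integral>\<^sup>+w. F w * G w \<partial>E) = (\<integral>\<^sup>+w. F w \<partial>E) * (\<integral>\<^sup>+w. G w \<partial>E)"
proof -
  define K where "K b = (if b then B else - B)" for b
  have "indep_vars (\<lambda>b. PiM (K b) (\<lambda>_. borel)) (\<lambda>b w. restrict (coordinate w) (K b)) UNIV"
    by (rule indep_vars_restrict[OF indep_coordinates]) (auto simp: K_def disjoint_family_on_def)
  then have "indep_vars (\<lambda>_. borel) (\<lambda>b w. (\<lambda>u. (if b then F else G) (decode (K b) u)) (restrict (coordinate w) (K b))) UNIV"
    by (rule indep_vars_compose2) (auto intro: measurable_compose[OF measurable_decode])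
  from indep_vars_nn_integral[OF _ this]
  have "(\<integral>\<^sup>+w. F (decode B (restrict (coordinate w) B)) * G (decode (- B) (restrict (coordinate w) (- B))) \<partial>E)
    = (\<integral>\<^sup>+w. F (decode B (restrict (coordinate w) B)) \<partial>E) * (\<integral>\<^sup>+w. G (decode (- B) (restrict (coordinate w) (- B))) \<partial>E)"
    by (simp add: UNIV_bool K_def ac_simps)
  moreover have "F (decode B (restrict (coordinate w) B)) = F w"
    "G (decode (- B) (restrict (coordinate w) (- B))) = G w" if "w \<in> space E" for w
    using that F G decode_coordinate[of w] by (auto simp: space_E)
  ultimately show ?thesis by (simp cong: nn_integral_cong)
qed

text \<open>Labels are i.i.d. and \<open>Cons j\<close> is injective, so the environment of the
  subtree at child \<open>j\<close> has the law of the whole environment.\<close>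

lemma measurable_shift [measurable]: "(\<lambda>w x. w (j # x)) \<in> E \<rightarrow>\<^sub>M E"
  and distr_shift: "distr E E (\<lambda>w x. w (j # x)) = E"
proof -
  show "(\<lambda>w x. w (j # x)) \<in> E \<rightarrow>\<^sub>M E"
    unfolding environment_law_def
    by (rule measurable_PiM_single') (auto simp: space_PiM)
  show "distr E E (\<lambda>w x. w (j # x)) = E"
    using distr_PiM_reindex[of UNIV "\<lambda>_. measure_pmf q \<Otimes>\<^sub>M \<mu>" "Cons j" UNIV] prob_space_qmu
    by (simp add: environment_law_def restrict_UNIV inj_on_def)
qed

lemma nn_integral_shift:
  assumes [measurable]: "F \<in> borel_measurable E"
  shows "(\<integral>\<^sup>+w. F (\<lambda>x. w (j # x)) \<partial>E) = (\<integral>\<^sup>+w. F w \<partial>E)"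
  by (subst (2) distr_shift[symmetric, of j], subst nn_integral_distr) simp_all

lemma distr_num_children: "distr E (count_space UNIV) (\<lambda>w. num_children w x) = measure_pmf q"
proof -
  have "distr E (count_space UNIV) (\<lambda>w. num_children w x)
      = distr (distr E (measure_pmf q \<Otimes>\<^sub>M \<mu>) (\<lambda>w. w x)) (count_space UNIV) fst"
    by (subst distr_distr) (auto simp: comp_def num_children_def[abs_def] intro: measurable_compose[OF measurable_fst])
  also have "distr E (measure_pmf q \<Otimes>\<^sub>M \<mu>) (\<lambda>w. w x) = measure_pmf q \<Otimes>\<^sub>M \<mu>"
    unfolding environment_law_def by (rule distr_PiM_component) (auto intro: prob_space_qmu)
  also have "distr (measure_pmf q \<Otimes>\<^sub>M \<mu>) (count_space UNIV) fst = distr (measure_pmf q \<Otimes>\<^sub>M \<mu>) (measure_pmf q) fst"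
    by (rule distr_cong) auto
  also have "\<dots> = measure_pmf q"
    by (rule mu.distr_pair_fst)
  finally show ?thesis .
qed

lemma integrable_num_children: "integrable E (\<lambda>w. real (num_children w x))"
  and integral_num_children: "(\<integral>w. real (num_children w x) \<partial>E) = mean_offspring q"
proof -
  have *: "(\<lambda>w. num_children w x) \<in> E \<rightarrow>\<^sub>M count_space UNIV" by simp
  show "integrable E (\<lambda>w. real (num_children w x))"
    using integrable_distr[OF *, of real] finite_mean by (simp add: distr_num_children)
  show "(\<integral>w. real (num_children w x) \<partial>E) = mean_offspring q"
    using integral_distr[OF *, of real] by (simp add: distr_num_children mean_offspring_def)
qed

lemma AE_num_children_pos: "AE w in E. \<forall>x. 0 < num_children w x"
proof (subst AE_all_countable, rule allI)
  fix x
  have "AE k in measure_pmf q. 0 < k"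
    using no_leaf by (auto simp: AE_measure_pmf_iff set_pmf_iff intro: gr0I)
  then have "AE k in distr E (count_space UNIV) (\<lambda>w. num_children w x). 0 < k"
    by (simp only: distr_num_children)
  then show "AE w in E. 0 < num_children w x"
    by (subst (asm) AE_distr_iff) auto
qed

end

section \<open>Moments of the level sums\<close>

declare omega.simps [simp del]

lemma omega_root_eq:
  "omega w root (Some [j]) = (if j < num_children w []
    then Aval w [j] / (1 + (\<Sum>l<num_children w []. Aval w [l])) else 0)"
  by (auto simp: parent_def omega.simps)

lemma level_sum_cong:
  assumes "\<And>x. fst (w x) = fst (w' x)" "\<And>x. x \<noteq> [] \<Longrightarrow> snd (w x) = snd (w' x)"
  shows "level_sum \<theta> n w = level_sum \<theta> n w'"
  using assms
proof (induction n arbitrary: w w')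
  case (Suc n)
  have "level_sum \<theta> n (\<lambda>x. w (j # x)) = level_sum \<theta> n (\<lambda>x. w' (j # x))" for j
    by (rule Suc.IH) (simp_all add: Suc.prems)
  moreover have "omega w root (Some [j]) = omega w' root (Some [j])" for j
    using Suc.prems by (simp add: omega_root_eq num_children_def Aval_def)
  ultimately show ?case using Suc.prems by (simp add: num_children_def)
qed simp

text \<open>The sum over a random number of children becomes a series over all \<open>j\<close>,
  which commutes with the expectation. Beyond the last child the weight is 0, and
  \<open>0 powr \<theta> = 0\<close> for every \<open>\<theta>\<close>, including 0.\<close>

lemma ennreal_level_sum_Suc:
  "ennreal (level_sum \<theta> (Suc n) w) =
    (\<Sum>j. ennreal (omega w root (Some [j]) powr \<theta>) * ennreal (level_sum \<theta> n (\<lambda>x. w (j # x))))"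
proof -
  have "ennreal (level_sum \<theta> (Suc n) w) =
      (\<Sum>j<num_children w []. ennreal (omega w root (Some [j]) powr \<theta>) * ennreal (level_sum \<theta> n (\<lambda>x. w (j # x))))"
    by (simp add: sum_ennreal[symmetric] ennreal_mult')
  also have "\<dots> = (\<Sum>j. ennreal (omega w root (Some [j]) powr \<theta>) * ennreal (level_sum \<theta> n (\<lambda>x. w (j # x))))"
    by (rule suminf_finite[symmetric]) (auto simp: omega_root_eq)
  finally show ?thesis .
qed

text \<open>
  \<open>Inr [j]\<close> is left out: the label \<open>A\<close> of child \<open>j\<close> enters the weights at the root, not the
  level sums of the subtree at \<open>j\<close>.
\<close>

definition branch :: "nat \<Rightarrow> (nat list + nat list) set" where
  "branch j = {Inl (j # x) |x. True} \<union> {Inr (j # x) |x. x \<noteq> []}"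

lemma level_sum_project_branch:
  "level_sum \<theta> n (\<lambda>x. project (branch j) w (j # x)) = level_sum \<theta> n (\<lambda>x. w (j # x))"
  by (rule level_sum_cong) (auto simp: project_def branch_def)

lemma level_sum_project_other_branch:
  "j \<noteq> k \<Longrightarrow> level_sum \<theta> n (\<lambda>x. project (- branch k) w (j # x)) = level_sum \<theta> n (\<lambda>x. w (j # x))"
  by (rule level_sum_cong) (auto simp: project_def branch_def)

lemma num_children_project_branch: "num_children (project (- branch k) w) [] = num_children w []"
  by (simp add: num_children_def project_def branch_def)

lemma omega_project_branch:
  "omega (project (- branch k) w) root (Some [j]) = omega w root (Some [j])"
  by (simp add: omega_root_eq num_children_def Aval_def project_def branch_def)

context gw_environment
begin

lemma measurable_omega [measurable]: "(\<lambda>w. omega w root (Some [j])) \<in> borel_measurable E"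
  unfolding omega_root_eq by measurable

lemma measurable_level_sum [measurable]: "level_sum \<theta> n \<in> borel_measurable E"
proof (induction n)
  case (Suc n)
  have [measurable]: "(\<lambda>w. level_sum \<theta> n (\<lambda>x. w (j # x))) \<in> borel_measurable E" for j
    by (rule measurable_compose[OF measurable_shift Suc.IH])
  show ?case by simp
qed simp

lemma measurable_level_sum_shift [measurable]:
  "(\<lambda>w. level_sum \<theta> n (\<lambda>x. w (j # x))) \<in> borel_measurable E"
  by (rule measurable_compose[OF measurable_shift measurable_level_sum])

definition phi :: "real \<Rightarrow> real" where
  "phi \<theta> = (\<integral>w. level_sum \<theta> 1 w \<partial>E)"

lemma psi_eq_ln_phi: "psi q \<mu> \<theta> = ln (phi \<theta>)"
  by (simp add: psi_def phi_def)

lemma omega_bounds: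
  assumes "w \<in> space E"
  shows "0 \<le> omega w root (Some [j])" "omega w root (Some [j]) \<le> 1"
    "j < num_children w [] \<Longrightarrow> 0 < omega w root (Some [j])"
    "j < num_children w [] \<Longrightarrow> omega w root (Some [j]) < 1"
    "(\<Sum>j<num_children w []. omega w root (Some [j])) \<le> 1"
    "0 < num_children w [] \<Longrightarrow> (\<Sum>j<num_children w []. omega w root (Some [j])) < 1"
proof -
  have pos: "Aval w x > 0" for x using assms by (simp add: space_E)
  note * = omega_root_bounds[OF pos]
  show "0 < omega w root (Some [j])" if "j < num_children w []" using *(1) that .
  show "omega w root (Some [j]) < 1" if "j < num_children w []" using *(2) that .
  show **: "(\<Sum>j<num_children w []. omega w root (Some [j])) < 1" if "0 < num_children w []" using *(3) that .
  show "0 \<le> omega w root (Some [j])" "omega w root (Some [j]) \<le> 1"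
    using *(1,2)[of j] by (cases "j < num_children w []"; simp add: omega_root_eq)+
  show "(\<Sum>j<num_children w []. omega w root (Some [j])) \<le> 1"
    using ** by (cases "num_children w [] = 0") auto
qed

lemma level_sum_1_le:
  assumes "w \<in> space E" "0 \<le> \<theta>"
  shows "level_sum \<theta> 1 w \<le> real (num_children w [])"
proof -
  have "(\<Sum>j<num_children w []. omega w root (Some [j]) powr \<theta>) \<le> (\<Sum>j<num_children w []. 1)"
    using omega_bounds(1,2)[OF assms(1)] assms(2) by (intro sum_mono powr_le1) auto
  then show ?thesis by simp
qed

lemma integrable_level_sum_1: "0 \<le> \<theta> \<Longrightarrow> integrable E (level_sum \<theta> 1)"
  by (rule Bochner_Integration.integrable_bound[OF integrable_num_children[of "[]"]])
    (auto simp: level_sum_1_le simp del: level_sum.simps One_nat_def intro!: AE_I2)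

lemma nn_integral_level_sum_1: "0 \<le> \<theta> \<Longrightarrow> (\<integral>\<^sup>+w. ennreal (level_sum \<theta> 1 w) \<partial>E) = ennreal (phi \<theta>)"
  unfolding phi_def by (rule nn_integral_eq_integral[OF integrable_level_sum_1])
    (auto simp del: level_sum.simps)

lemma phi_pos:
  assumes "0 \<le> \<theta>" shows "0 < phi \<theta>"
proof -
  have "0 \<le> phi \<theta>" by (simp add: phi_def del: level_sum.simps)
  moreover have "phi \<theta> \<noteq> 0"
  proof
    assume "phi \<theta> = 0"
    then have "AE w in E. level_sum \<theta> 1 w = 0"
      unfolding phi_def by (subst (asm) integral_nonneg_eq_0_iff_AE[OF integrable_level_sum_1[OF assms]])
        (auto simp del: level_sum.simps)
    then have "AE w in E. False"
      using AE_num_children_pos AE_space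
    proof eventually_elim
      case (elim w)
      have "0 < num_children w []" using elim by blast
      then have "0 < (\<Sum>j<num_children w []. omega w root (Some [j]) powr \<theta>)"
        using omega_bounds(3)[of w] elim by (intro sum_pos) force+
      with elim show False by simp
    qed
    then show False using AE_False by (simp add: emeasure_space_1) 
  qed
  ultimately show ?thesis by simp
qed

lemma nn_integral_sum_omega:
  assumes "0 \<le> \<theta>"
  shows "(\<Sum>j. \<integral>\<^sup>+w. ennreal (omega w root (Some [j]) powr \<theta>) \<partial>E) = ennreal (phi \<theta>)"
proof -
  have "(\<Sum>j. \<integral>\<^sup>+w. ennreal (omega w root (Some [j]) powr \<theta>) \<partial>E)
      = (\<integral>\<^sup>+w. (\<Sum>j. ennreal (omega w root (Some [j]) powr \<theta>)) \<partial>E)"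
    by (rule nn_integral_suminf[symmetric]) measurable
  also have "\<dots> = (\<integral>\<^sup>+w. ennreal (level_sum \<theta> 1 w) \<partial>E)"
    using ennreal_level_sum_Suc[of \<theta> 0] by (intro nn_integral_cong) simp
  finally show ?thesis using nn_integral_level_sum_1[OF assms] by simp
qed

text \<open>Branching property: in each term the weight and the level sum of the subtree read
  disjoint labels, and the latter has the law of the level sum itself, so every generation
  contributes a factor \<open>phi \<theta>\<close>.\<close>

lemma nn_integral_level_sum:
  assumes \<theta>: "0 \<le> \<theta>"
  shows "(\<integral>\<^sup>+w. ennreal (level_sum \<theta> n w) \<partial>E) = ennreal (phi \<theta> ^ n)"
proof (induction n)
  case (Suc n)
  let ?b = "\<lambda>j w. ennreal (omega w root (Some [j]) powr \<theta>)"
  let ?Y = "\<lambda>j w. ennreal (level_sum \<theta> n (\<lambda>x. w (j # x)))"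
  have "(\<integral>\<^sup>+w. ?b j w * ?Y j w \<partial>E) = (\<integral>\<^sup>+w. ?b j w \<partial>E) * ennreal (phi \<theta> ^ n)" for j
  proof -
    have "(\<integral>\<^sup>+w. ?b j w * ?Y j w \<partial>E) = (\<integral>\<^sup>+w. ?b j w \<partial>E) * (\<integral>\<^sup>+w. ?Y j w \<partial>E)"
      by (rule nn_integral_indep_mult[where B = "- branch j"])
        (simp_all add: omega_project_branch level_sum_project_branch)
    also have "(\<integral>\<^sup>+w. ?Y j w \<partial>E) = ennreal (phi \<theta> ^ n)"
      using nn_integral_shift[of "\<lambda>w. ennreal (level_sum \<theta> n w)"] Suc.IH by simp
    finally show ?thesis .
  qed
  note * = this
  have "(\<integral>\<^sup>+w. ennreal (level_sum \<theta> (Suc n) w) \<partial>E) = (\<Sum>j. \<integral>\<^sup>+w. ?b j w * ?Y j w \<partial>E)"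
    unfolding ennreal_level_sum_Suc by (rule nn_integral_suminf) measurable
  also have "\<dots> = (\<Sum>j. \<integral>\<^sup>+w. ?b j w \<partial>E) * ennreal (phi \<theta> ^ n)"
    unfolding * by (rule ennreal_suminf_multc)
  also have "\<dots> = ennreal (phi \<theta> ^ Suc n)"
    unfolding nn_integral_sum_omega[OF \<theta>] using phi_pos[OF \<theta>] by (simp add: ennreal_mult')
  finally show ?case .
qed (simp add: emeasure_space_1)

text \<open>
  The subtrees are replaced by their mean one at a time: the subtree at child \<open>k\<close> is independent
  of everything else in the sum, so each replacement costs at most
  \<open>E[omega(e,e\<^sub>k) powr (p \<theta>)]\<close> times the \<open>p\<close>-th moment at level \<open>n\<close>.
\<close>

lemma moment_level_sum_Suc:
  assumes \<theta>: "0 < \<theta>" and p: "1 < p" "p \<le> 2"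
  shows "(\<integral>\<^sup>+w. ennreal (level_sum \<theta> (Suc n) w powr p) \<partial>E)
    \<le> (\<integral>\<^sup>+w. ennreal (level_sum \<theta> 1 w powr p) \<partial>E) * ennreal (phi \<theta> powr (p * n))
      + ennreal (phi (p * \<theta>)) * (\<integral>\<^sup>+w. ennreal (level_sum \<theta> n w powr p) \<partial>E)"
proof -
  define m where "m = phi \<theta> ^ n"
  have phi: "0 < phi \<theta>" using \<theta> by (intro phi_pos) auto
  have m: "0 < m" unfolding m_def using phi by simp
  define M where "M = (\<integral>\<^sup>+w. ennreal (level_sum \<theta> n w powr p) \<partial>E)"
  define b where "b j w = omega w root (Some [j]) powr \<theta>" for j and w :: env
  define Y where "Y j w = level_sum \<theta> n (\<lambda>x. w (j # x))" for j w
  \<comment> \<open>Hybrid sum: the subtrees at children below \<open>k\<close> are kept, the others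
    are replaced by their mean \<open>m\<close>. \<open>R k\<close> omits the term of child
    \<open>k\<close>, the only one in which \<open>T k\<close> and \<open>T (Suc k)\<close>
    differ.\<close>
  define T where "T k w = (\<Sum>j<num_children w []. b j w * (if j < k then Y j w else m))" for k w
  define R where "R k w = (\<Sum>j<num_children w []. if j = k then 0 else b j w * (if j < k then Y j w else m))" for k w
  have b0: "0 \<le> b j w" and Y0: "0 \<le> Y j w" for j w by (simp_all add: b_def Y_def)
  have R0: "0 \<le> R k w" for k w
    unfolding R_def using b0 Y0 m by (intro sum_nonneg) auto
  have [measurable]: "b j \<in> borel_measurable E" "Y j \<in> borel_measurable E" for j
    unfolding b_def Y_def by measurable
  have [measurable]: "T k \<in> borel_measurable E" "R k \<in> borel_measurable E" for k
    unfolding T_def R_def by measurable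
  have T_Suc: "T (Suc k) w = R k w + b k w * Y k w" and T_eq: "T k w = R k w + b k w * m" for k w
  proof -
    have "T (Suc k) w = (\<Sum>j<num_children w []. (if j = k then 0 else b j w * (if j < k then Y j w else m)) + (if j = k then b k w * Y k w else 0))"
      unfolding T_def by (intro sum.cong) auto
    also have "\<dots> = R k w + b k w * Y k w"
      by (simp add: R_def sum.distrib b_def omega_root_eq)
    finally show "T (Suc k) w = R k w + b k w * Y k w" .
    have "T k w = (\<Sum>j<num_children w []. (if j = k then 0 else b j w * (if j < k then Y j w else m)) + (if j = k then b k w * m else 0))"
      unfolding T_def by (intro sum.cong) auto
    also have "\<dots> = R k w + b k w * m"
      by (simp add: R_def sum.distrib b_def omega_root_eq)
    finally show "T k w = R k w + b k w * m" .
  qed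
  have R_proj: "R k (project (- branch k) w) = R k w" and b_proj: "b j (project (- branch k) w) = b j w"
    and Y_proj: "Y k (project (branch k) w) = Y k w" for j k w
    by (simp_all add: R_def b_def Y_def num_children_project_branch omega_project_branch
        level_sum_project_branch level_sum_project_other_branch cong: sum.cong if_cong)
  have EY: "(\<integral>\<^sup>+w. ennreal (Y k w) \<partial>E) = ennreal m" for k
    unfolding Y_def m_def using nn_integral_shift[of "\<lambda>w. ennreal (level_sum \<theta> n w)"] nn_integral_level_sum[of \<theta> n] \<theta> by simp
  have EYp: "(\<integral>\<^sup>+w. ennreal (Y k w powr p) \<partial>E) = M" for k
    unfolding Y_def M_def using nn_integral_shift[of "\<lambda>w. ennreal (level_sum \<theta> n w powr p)"] by simp
  define B where "B k = (\<integral>\<^sup>+w. ennreal (b k w powr p) \<partial>E)" for k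
  \<comment> \<open>Expanding \<open>T (Suc k)\<close> from above and \<open>T k\<close> from below
    around \<open>R k\<close> gives the same linear term in expectation, since the subtree at
    \<open>k\<close> has mean \<open>m\<close> and is independent of \<open>R k\<close> and
    \<open>b k\<close>. Only the \<open>p\<close>-th moment of the replaced term remains.\<close>
  have step: "(\<integral>\<^sup>+w. ennreal (T (Suc k) w powr p) \<partial>E) \<le> (\<integral>\<^sup>+w. ennreal (T k w powr p) \<partial>E) + B k * M" for k
  proof -
    have "(\<integral>\<^sup>+w. ennreal (T (Suc k) w powr p) \<partial>E)
        \<le> (\<integral>\<^sup>+w. ennreal (R k w powr p) + ennreal (p * R k w powr (p - 1) * b k w) * ennreal (Y k w)
              + ennreal (b k w powr p) * ennreal (Y k w powr p) \<partial>E)"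
    proof (rule nn_integral_mono)
      fix w
      have "T (Suc k) w powr p \<le> R k w powr p + p * R k w powr (p - 1) * (b k w * Y k w) + (b k w * Y k w) powr p"
        unfolding T_Suc using R0 b0 Y0 p by (intro powr_add_upper) auto
      also have "\<dots> = R k w powr p + (p * R k w powr (p - 1) * b k w) * Y k w + b k w powr p * Y k w powr p"
        using b0[of k w] Y0[of k w] by (simp add: powr_mult)
      finally have "ennreal (T (Suc k) w powr p) \<le> ennreal \<dots>" by (rule ennreal_leI)
      also have "\<dots> = ennreal (R k w powr p) + ennreal (p * R k w powr (p - 1) * b k w) * ennreal (Y k w)
              + ennreal (b k w powr p) * ennreal (Y k w powr p)"
        using R0 b0 Y0 p by (simp add: ennreal_plus ennreal_mult)
      finally show "ennreal (T (Suc k) w powr p) \<le> \<dots>" .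
    qed
    also have "\<dots> = (\<integral>\<^sup>+w. ennreal (R k w powr p) \<partial>E)
        + (\<integral>\<^sup>+w. ennreal (p * R k w powr (p - 1) * b k w) * ennreal (Y k w) \<partial>E)
        + (\<integral>\<^sup>+w. ennreal (b k w powr p) * ennreal (Y k w powr p) \<partial>E)"
      by (simp add: nn_integral_add)
    also have "(\<integral>\<^sup>+w. ennreal (p * R k w powr (p - 1) * b k w) * ennreal (Y k w) \<partial>E)
        = (\<integral>\<^sup>+w. ennreal (p * R k w powr (p - 1) * b k w) \<partial>E) * ennreal m"
      by (subst nn_integral_indep_mult[where B = "- branch k"]) (simp_all add: R_proj b_proj Y_proj EY)
    also have "\<dots> = (\<integral>\<^sup>+w. ennreal (p * R k w powr (p - 1) * b k w) * ennreal m \<partial>E)"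
      by (rule nn_integral_multc[symmetric]) measurable
    also have "(\<integral>\<^sup>+w. ennreal (b k w powr p) * ennreal (Y k w powr p) \<partial>E) = B k * M"
      by (subst nn_integral_indep_mult[where B = "- branch k"]) (simp_all add: b_proj Y_proj EYp B_def)
    also have "(\<integral>\<^sup>+w. ennreal (R k w powr p) \<partial>E) + (\<integral>\<^sup>+w. ennreal (p * R k w powr (p - 1) * b k w) * ennreal m \<partial>E)
        = (\<integral>\<^sup>+w. ennreal (R k w powr p) + ennreal (p * R k w powr (p - 1) * b k w) * ennreal m \<partial>E)"
      by (rule nn_integral_add[symmetric]) measurable
    also have "\<dots> \<le> (\<integral>\<^sup>+w. ennreal (T k w powr p) \<partial>E)"
    proof (rule nn_integral_mono)
      fix w
      have "R k w powr p + p * R k w powr (p - 1) * (b k w * m) \<le> T k w powr p"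
        unfolding T_eq using R0 b0 m p by (intro powr_add_lower) auto
      then have "ennreal (R k w powr p + (p * R k w powr (p - 1) * b k w) * m) \<le> ennreal (T k w powr p)"
        by (intro ennreal_leI) (simp add: mult.assoc)
      then show "ennreal (R k w powr p) + ennreal (p * R k w powr (p - 1) * b k w) * ennreal m \<le> ennreal (T k w powr p)"
        using R0 b0 m p by (simp add: ennreal_plus ennreal_mult)
    qed
    finally show ?thesis by (simp add: add_right_mono)
  qed
  have sum_B: "(\<Sum>j<k. B j) \<le> ennreal (phi (p * \<theta>))" for k
  proof -
    have "B j = (\<integral>\<^sup>+w. ennreal (omega w root (Some [j]) powr (p * \<theta>)) \<partial>E)" for j
      by (simp add: B_def b_def powr_powr mult.commute)
    then have "(\<Sum>j. B j) = ennreal (phi (p * \<theta>))"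
      using nn_integral_sum_omega[of "p * \<theta>"] \<theta> p by simp
    moreover have "(\<Sum>j<k. B j) \<le> (\<Sum>j. B j)"
      by (rule sum_le_suminf) auto
    ultimately show ?thesis by simp
  qed
  have T_le: "(\<integral>\<^sup>+w. ennreal (T k w powr p) \<partial>E) \<le> (\<integral>\<^sup>+w. ennreal (T 0 w powr p) \<partial>E) + (\<Sum>j<k. B j) * M" for k
  proof (induction k)
    case (Suc k)
    have "(\<integral>\<^sup>+w. ennreal (T (Suc k) w powr p) \<partial>E) \<le> (\<integral>\<^sup>+w. ennreal (T 0 w powr p) \<partial>E) + (\<Sum>j<k. B j) * M + B k * M"
      using step[of k] Suc.IH by (meson add_right_mono order_trans)
    then show ?case by (simp add: distrib_right add.assoc)
  qed simp
  have T0: "(\<integral>\<^sup>+w. ennreal (T 0 w powr p) \<partial>E) = (\<integral>\<^sup>+w. ennreal (level_sum \<theta> 1 w powr p) \<partial>E) * ennreal (phi \<theta> powr (p * n))"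
  proof -
    have "T 0 w = level_sum \<theta> 1 w * m" for w
      by (simp add: T_def b_def sum_distrib_right)
    moreover have "m powr p = phi \<theta> powr (p * n)"
      unfolding m_def using phi by (simp add: powr_realpow[symmetric] powr_powr mult.commute)
    ultimately have "ennreal (T 0 w powr p) = ennreal (level_sum \<theta> 1 w powr p) * ennreal (phi \<theta> powr (p * n))" for w
      using m by (simp add: powr_mult ennreal_mult del: One_nat_def level_sum.simps)
    then show ?thesis
      by (simp add: nn_integral_multc del: One_nat_def level_sum.simps)
  qed
  \<comment> \<open>The number of children may be unbounded, so no single \<open>k\<close> need
    suffice; \<open>T k\<close> equals the full sum once \<open>k\<close> reaches that number, and
    Fatou's lemma passes to the limit.\<close>
  have "(\<integral>\<^sup>+w. ennreal (level_sum \<theta> (Suc n) w powr p) \<partial>E) = (\<integral>\<^sup>+w. liminf (\<lambda>k. ennreal (T k w powr p)) \<partial>E)"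
  proof (rule nn_integral_cong)
    fix w
    have "eventually (\<lambda>k. ennreal (T k w powr p) = ennreal (level_sum \<theta> (Suc n) w powr p)) sequentially"
      using eventually_ge_at_top[of "num_children w []"]
    proof eventually_elim
      case (elim k)
      then have "T k w = level_sum \<theta> (Suc n) w"
        unfolding T_def by (auto simp: b_def Y_def intro!: sum.cong)
      then show ?case by simp
    qed
    then have "(\<lambda>k. ennreal (T k w powr p)) \<longlonglongrightarrow> ennreal (level_sum \<theta> (Suc n) w powr p)"
      by (rule tendsto_eventually)
    then show "ennreal (level_sum \<theta> (Suc n) w powr p) = liminf (\<lambda>k. ennreal (T k w powr p))"
      by (intro lim_imp_Liminf[symmetric]) auto
  qed
  also have "\<dots> \<le> liminf (\<lambda>k. \<integral>\<^sup>+w. ennreal (T k w powr p) \<partial>E)"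
    by (rule nn_integral_liminf) measurable
  also have "\<dots> \<le> (\<integral>\<^sup>+w. ennreal (T 0 w powr p) \<partial>E) + ennreal (phi (p * \<theta>)) * M"
  proof -
    have "(\<integral>\<^sup>+w. ennreal (T k w powr p) \<partial>E) \<le> (\<integral>\<^sup>+w. ennreal (T 0 w powr p) \<partial>E) + ennreal (phi (p * \<theta>)) * M" for k
      using T_le[of k] sum_B[of k] by (meson add_left_mono mult_right_mono order_trans zero_le)
    then have "liminf (\<lambda>k. \<integral>\<^sup>+w. ennreal (T k w powr p) \<partial>E) \<le> liminf (\<lambda>k::nat. (\<integral>\<^sup>+w. ennreal (T 0 w powr p) \<partial>E) + ennreal (phi (p * \<theta>)) * M)"
      by (intro Liminf_mono always_eventually allI)
    then show ?thesis by (simp add: Liminf_const)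
  qed
  finally show ?thesis unfolding T0 M_def .
qed

end

section \<open>Growth rate of the level sums\<close>

text \<open>Hoelder over the children of the root, with the induction hypothesis in each
  subtree.\<close>

lemma level_sum_log_convex:
  assumes pos: "\<And>x. Aval w x > 0" and t: "0 < t" "t < 1"
  shows "level_sum ((1 - t) * a + t * b) n w \<le> level_sum a n w powr (1 - t) * level_sum b n w powr t"
  using pos
proof (induction n arbitrary: w)
  case (Suc n)
  let ?o = "\<lambda>j. omega w root (Some [j])"
  let ?Z = "\<lambda>c j. level_sum c n (\<lambda>x. w (j # x))"
  have o: "0 < ?o j" if "j < num_children w []" for j
    using omega_root_bounds(1)[OF Suc.prems that] .
  have "level_sum ((1 - t) * a + t * b) (Suc n) w
      \<le> (\<Sum>j<num_children w []. (?o j powr a * ?Z a j) powr (1 - t) * (?o j powr b * ?Z b j) powr t)"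
    unfolding level_sum.simps
  proof (rule sum_mono)
    fix j assume "j \<in> {..<num_children w []}"
    have "?Z ((1 - t) * a + t * b) j \<le> ?Z a j powr (1 - t) * ?Z b j powr t"
      by (rule Suc.IH) (use Suc.prems in \<open>simp add: Aval_def\<close>)
    then have "?o j powr ((1 - t) * a + t * b) * ?Z ((1 - t) * a + t * b) j
        \<le> ?o j powr ((1 - t) * a + t * b) * (?Z a j powr (1 - t) * ?Z b j powr t)"
      by (intro mult_left_mono) auto
    also have "\<dots> = (?o j powr a * ?Z a j) powr (1 - t) * (?o j powr b * ?Z b j) powr t"
      by (simp add: powr_mult powr_powr powr_add mult_ac)
    finally show "?o j powr ((1 - t) * a + t * b) * ?Z ((1 - t) * a + t * b) j \<le> \<dots>" .
  qed
  also have "\<dots> \<le> level_sum a (Suc n) w powr (1 - t) * level_sum b (Suc n) w powr t"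
    unfolding level_sum.simps by (rule sum_powr_mult_le) (use t in auto)
  finally show ?case .
qed simp

text \<open>Subadditivity of the power \<open>\<theta> \<le> 1\<close>, used once per
  generation.\<close>

lemma level_sum_1_powr_le:
  assumes pos: "\<And>x. Aval w x > 0" and \<theta>: "0 < \<theta>" "\<theta> \<le> 1"
  shows "level_sum 1 n w powr \<theta> \<le> level_sum \<theta> n w"
  using pos
proof (induction n arbitrary: w)
  case (Suc n)
  let ?o = "\<lambda>j. omega w root (Some [j])"
  let ?Z = "\<lambda>c j. level_sum c n (\<lambda>x. w (j # x))"
  have "level_sum 1 (Suc n) w powr \<theta> \<le> (\<Sum>j<num_children w []. (?o j powr 1 * ?Z 1 j) powr \<theta>)"
    unfolding level_sum.simps using \<theta> by (intro powr_sum_le) auto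
  also have "\<dots> \<le> (\<Sum>j<num_children w []. ?o j powr \<theta> * ?Z \<theta> j)"
  proof (rule sum_mono)
    fix j assume "j \<in> {..<num_children w []}"
    have "?Z 1 j powr \<theta> \<le> ?Z \<theta> j"
      by (rule Suc.IH) (use Suc.prems in \<open>simp add: Aval_def\<close>)
    then have "?o j powr \<theta> * ?Z 1 j powr \<theta> \<le> ?o j powr \<theta> * ?Z \<theta> j"
      by (intro mult_left_mono) auto
    moreover have "(?o j powr 1 * ?Z 1 j) powr \<theta> = ?o j powr \<theta> * ?Z 1 j powr \<theta>"
      by (simp only: powr_mult powr_powr mult_1)
    ultimately show "(?o j powr 1 * ?Z 1 j) powr \<theta> \<le> ?o j powr \<theta> * ?Z \<theta> j" by simp
  qed
  finally show ?case by simp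
qed simp

lemma level_sum_pos:
  assumes "\<And>x. Aval w x > 0" "\<And>x. 0 < num_children w x"
  shows "0 < level_sum \<theta> n w"
  using assms
proof (induction n arbitrary: w)
  case (Suc n)
  have "0 < level_sum \<theta> n (\<lambda>x. w (j # x))" for j
    using Suc.prems by (intro Suc.IH) (simp_all add: Aval_def num_children_def)
  moreover have "0 < omega w root (Some [j])" if "j < num_children w []" for j
    using omega_root_bounds(1)[OF Suc.prems(1) that] .
  ultimately have "0 < omega w root (Some [j]) powr \<theta> * level_sum \<theta> n (\<lambda>x. w (j # x))"
    if "j < num_children w []" for j
    using that by (intro mult_pos_pos) (simp_all add: less_imp_neq[symmetric])
  then show ?case
    using Suc.prems(2)[of "[]"] unfolding level_sum.simps
    by (intro sum_pos) (auto simp: lessThan_empty_iff)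
qed simp

text \<open>
  The constant \<open>(4 C) powr (1 / (p - 1))\<close> makes the part of the expectation carried by
  large values at most \<open>m / 4\<close>.
\<close>

lemma (in prob_space) prob_ge_half_mean:
  fixes W :: "'a \<Rightarrow> real"
  assumes [measurable]: "W \<in> borel_measurable M" and W: "\<And>x. 0 \<le> W x"
    and mean: "(\<integral>\<^sup>+x. ennreal (W x) \<partial>M) = ennreal m" and m: "0 < m"
    and p: "1 < p" and C: "0 < C"
    and mom: "(\<integral>\<^sup>+x. ennreal (W x powr p) \<partial>M) \<le> ennreal (C * m powr p)"
  shows "1 / (4 * (4 * C) powr (1 / (p - 1))) \<le> prob {x \<in> space M. m / 2 \<le> W x}"
proof -
  define c where "c = (4 * C) powr (1 / (p - 1))"
  have c: "c > 0" using C by (simp add: c_def)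
  have cp: "c powr (1 - p) = 1 / (4 * C)"
  proof -
    have "(1 / (p - 1)) * (1 - p) = -1" using p by (simp add: field_simps)
    then show ?thesis using C by (simp add: c_def powr_powr powr_minus_divide)
  qed
  define S where "S = {x \<in> space M. m / 2 \<le> W x}"
  have [measurable]: "S \<in> sets M" unfolding S_def by measurable
  \<comment> \<open>Below \<open>m / 2\<close> the first term suffices, between \<open>m / 2\<close>
    and \<open>c * m\<close> the indicator term does. Above \<open>c * m\<close> the factor
    \<open>W x powr (1 - p)\<close> has a negative exponent and is at most
    \<open>(c * m) powr (1 - p)\<close>.\<close>
  have le: "W x \<le> m / 2 + c * m * indicator S x + W x powr p * (c * m) powr (1 - p)" if x: "x \<in> space M" for x
  proof -
    consider "W x < m / 2" | "m / 2 \<le> W x" "W x \<le> c * m" | "W x > c * m" by linarith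
    then show ?thesis
    proof cases
      case 1
      moreover have "0 \<le> c * m * indicator S x + W x powr p * (c * m) powr (1 - p)"
        using c m by (intro add_nonneg_nonneg mult_nonneg_nonneg) auto
      ultimately show ?thesis by linarith
    next
      case 2
      then have "indicator S x = (1::real)" using x by (simp add: S_def)
      have "0 \<le> W x powr p * (c * m) powr (1 - p)" by simp
      then have "W x \<le> m / 2 + c * m * 1 + W x powr p * (c * m) powr (1 - p)"
        using 2 m by linarith
      with \<open>indicator S x = (1::real)\<close> show ?thesis by simp
    next
      case 3
      have cm: "0 < c * m" using c m by simp
      then have "0 < W x" using 3 by linarith
      then have "W x = W x powr p * W x powr (1 - p)"
        by (simp add: powr_add[symmetric])
      also have "\<dots> \<le> W x powr p * (c * m) powr (1 - p)"
        using 3 cm p by (intro mult_left_mono powr_mono2') auto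
      finally have "W x \<le> W x powr p * (c * m) powr (1 - p)" .
      moreover have "0 \<le> c * m * indicator S x" using c m by simp
      ultimately show ?thesis using m by linarith
    qed
  qed
  have "ennreal m \<le> (\<integral>\<^sup>+x. ennreal (m / 2) + ennreal (c * m) * indicator S x + ennreal (W x powr p) * ennreal ((c * m) powr (1 - p)) \<partial>M)"
    unfolding mean[symmetric]
  proof (rule nn_integral_mono)
    fix x assume "x \<in> space M"
    then have "ennreal (W x) \<le> ennreal (m / 2 + c * m * indicator S x + W x powr p * (c * m) powr (1 - p))"
      by (intro ennreal_leI le)
    also have "\<dots> = ennreal (m / 2) + ennreal (c * m) * indicator S x + ennreal (W x powr p) * ennreal ((c * m) powr (1 - p))"
      using c m by (auto simp: ennreal_plus ennreal_mult indicator_def)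
    finally show "ennreal (W x) \<le> \<dots>" .
  qed
  also have "\<dots> = ennreal (m / 2) + ennreal (c * m) * emeasure M S + (\<integral>\<^sup>+x. ennreal (W x powr p) \<partial>M) * ennreal ((c * m) powr (1 - p))"
    by (simp add: nn_integral_add nn_integral_multc nn_integral_cmult_indicator emeasure_space_1)
  also have "\<dots> \<le> ennreal (m / 2) + ennreal (c * m) * ennreal (prob S) + ennreal (C * m powr p) * ennreal ((c * m) powr (1 - p))"
    using mom by (intro add_mono mult_right_mono) (auto simp: emeasure_eq_measure)
  also have "\<dots> = ennreal (m / 2 + c * m * prob S + C * m powr p * (c * m) powr (1 - p))"
    using c m C by (simp add: ennreal_plus ennreal_mult)
  finally have "m \<le> m / 2 + c * m * prob S + C * m powr p * (c * m) powr (1 - p)"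
    using c m C by (subst (asm) ennreal_le_iff) (auto intro!: add_nonneg_nonneg mult_nonneg_nonneg)
  also have "C * m powr p * (c * m) powr (1 - p) = m / 4"
  proof -
    have "m powr p * m powr (1 - p) = m" using m by (simp add: powr_add[symmetric])
    then show ?thesis using c m C by (simp add: powr_mult cp)
  qed
  finally have "m * (1 / 4) \<le> m * (c * prob S)" by (simp add: field_simps)
  then have "1 / 4 \<le> c * prob S" using m by simp
  then show ?thesis unfolding c_def[symmetric] S_def[symmetric] using c by (simp add: field_simps)
qed

lemma (in prob_space) tendsto_prob_deviation:
  fixes X :: "nat \<Rightarrow> 'a \<Rightarrow> real"
  assumes [measurable]: "\<And>n. X n \<in> borel_measurable M"
    and lim: "AE x in M. (\<lambda>n. X n x) \<longlonglongrightarrow> L" and \<epsilon>: "0 < \<epsilon>"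
  shows "(\<lambda>n. prob {x \<in> space M. \<epsilon> \<le> \<bar>X n x - L\<bar>}) \<longlonglongrightarrow> 0"
proof -
  let ?S = "\<lambda>n. {x \<in> space M. \<epsilon> \<le> \<bar>X n x - L\<bar>}"
  have "(\<lambda>n. \<integral>x. indicator (?S n) x \<partial>M) \<longlonglongrightarrow> (\<integral>x. (0 :: real) \<partial>M)"
  proof (rule integral_dominated_convergence[where w = "\<lambda>_. 1"])
    show "AE x in M. (\<lambda>n. indicator (?S n) x :: real) \<longlonglongrightarrow> 0"
      using lim
    proof eventually_elim
      case (elim x)
      then have "eventually (\<lambda>n. dist (X n x) L < \<epsilon>) sequentially"
        using \<epsilon> by (rule tendstoD)
      then have "eventually (\<lambda>n. (indicator (?S n) x :: real) = 0) sequentially"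
        by eventually_elim (auto simp: dist_real_def indicator_def)
      then show ?case by (rule tendsto_eventually)
    qed
  qed (auto simp: indicator_def)
  then show ?thesis by simp
qed

text \<open>Takes the place of a zero-one law: an event of probability at least
  \<open>\<delta>\<close> cannot be covered by two events whose probabilities vanish. One good point
  for a large \<open>n\<close> is enough later, because the inequality read off there is between
  constants.\<close>

lemma (in prob_space) eventually_ex_outside:
  assumes "\<And>n. A n \<in> events" "\<And>n. B n \<in> events" "\<And>n. C n \<in> events"
    and A: "\<And>n. \<delta> \<le> prob (A n)" and \<delta>: "0 < \<delta>"
    and B: "(\<lambda>n. prob (B n)) \<longlonglongrightarrow> 0" and C: "(\<lambda>n. prob (C n)) \<longlonglongrightarrow> 0"
  shows "eventually (\<lambda>n. \<exists>x\<in>A n. x \<notin> B n \<and> x \<notin> C n) sequentially"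
proof -
  have "eventually (\<lambda>n. prob (B n) < \<delta> / 2) sequentially" "eventually (\<lambda>n. prob (C n) < \<delta> / 2) sequentially"
    using \<delta> by (auto intro!: order_tendstoD(2)[OF B] order_tendstoD(2)[OF C] simp del: less_divide_eq_numeral1)
  then show ?thesis
  proof eventually_elim
    case (elim n)
    show ?case
    proof (rule ccontr)
      assume "\<not> ?thesis"
      then have "prob (A n) \<le> prob (B n \<union> C n)"
        using assms by (intro finite_measure_mono) auto
      also have "\<dots> \<le> prob (B n) + prob (C n)"
        using assms by (intro measure_Un_le) auto
      finally show False using elim A[of n] by simp
    qed
  qed
qed

context gw_environment
begin

text \<open>Hoelder against the constant 1, with weights summing to at most 1, bounds the first
  level sum by \<nu> to the power \<open>1 - \<theta>\<close>. The condition on \<open>p\<close>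
  then makes its \<open>p\<close>-th power at most \<nu>, which is integrable.\<close>

lemma moment_level_sum_1_finite:
  assumes \<theta>: "0 < \<theta>" "\<theta> < 1" and p: "1 < p" "p * (1 - \<theta>) \<le> 1"
  shows "(\<integral>\<^sup>+w. ennreal (level_sum \<theta> 1 w powr p) \<partial>E) < \<infinity>"
proof -
  have "level_sum \<theta> 1 w powr p \<le> real (num_children w [])" if w: "w \<in> space E" for w
  proof (cases "num_children w [] = 0")
    case False
    let ?k = "num_children w []"
    let ?o = "\<lambda>j. omega w root (Some [j])"
    have "level_sum \<theta> 1 w = (\<Sum>j<?k. 1 powr (1 - \<theta>) * ?o j powr \<theta>)" by simp
    also have "\<dots> \<le> (\<Sum>j<?k. 1) powr (1 - \<theta>) * (\<Sum>j<?k. ?o j) powr \<theta>"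
      using \<theta> omega_bounds(1)[OF w] by (intro sum_powr_mult_le) auto
    also have "\<dots> \<le> (\<Sum>j<?k. 1) powr (1 - \<theta>) * 1"
      using \<theta> omega_bounds(1,5)[OF w]
      by (intro mult_left_mono powr_le1) (auto simp: abs_of_nonneg sum_nonneg)
    finally have "level_sum \<theta> 1 w \<le> real ?k powr (1 - \<theta>)" by simp
    then have "level_sum \<theta> 1 w powr p \<le> (real ?k powr (1 - \<theta>)) powr p"
      using p by (intro powr_mono2) (auto simp del: level_sum.simps)
    also have "\<dots> = real ?k powr (p * (1 - \<theta>))" by (simp add: powr_powr mult.commute)
    also have "\<dots> \<le> real ?k powr 1" using False p by (intro powr_mono) auto
    finally show ?thesis using False by simp
  qed simp
  then have "(\<integral>\<^sup>+w. ennreal (level_sum \<theta> 1 w powr p) \<partial>E) \<le> (\<integral>\<^sup>+w. ennreal (real (num_children w [])) \<partial>E)"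
    by (intro nn_integral_mono ennreal_leI)
  also have "\<dots> = ennreal (mean_offspring q)"
    using nn_integral_eq_integral[OF integrable_num_children[of "[]"]] by (simp add: integral_num_children)
  also have "\<dots> < \<infinity>" by simp
  finally show ?thesis .
qed

lemma moment_level_sum_bounded:
  assumes \<theta>: "0 < \<theta>" "\<theta> < 1" and p: "1 < p" "p \<le> 2" "p * (1 - \<theta>) \<le> 1"
    and contract: "phi (p * \<theta>) < phi \<theta> powr p"
  shows "\<exists>C>0. \<forall>n. (\<integral>\<^sup>+w. ennreal (level_sum \<theta> n w powr p) \<partial>E) \<le> ennreal (C * (phi \<theta> ^ n) powr p)"
proof -
  have phi: "0 < phi \<theta>" "0 < phi (p * \<theta>)" using \<theta> p by (auto intro!: phi_pos)
  have pw: "(phi \<theta> ^ n) powr p = phi \<theta> powr (p * n)" for n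
    using phi by (simp add: powr_realpow[symmetric] powr_powr mult.commute)
  define a where "a = enn2real (\<integral>\<^sup>+w. ennreal (level_sum \<theta> 1 w powr p) \<partial>E)"
  have a: "(\<integral>\<^sup>+w. ennreal (level_sum \<theta> 1 w powr p) \<partial>E) = ennreal a" "0 \<le> a"
    unfolding a_def using moment_level_sum_1_finite[OF \<theta> p(1,3)] by (simp_all add: ennreal_enn2real_if)
  \<comment> \<open>The quotient is the fixed point of the recursion for the moments divided by
    \<open>phi \<theta> powr (p * n)\<close>; its denominator is positive by
    \<open>contract\<close>. The maximum with 1 covers \<open>n = 0\<close>.\<close>
  define C where "C = max 1 (a / (phi \<theta> powr p - phi (p * \<theta>)))"
  have C: "1 \<le> C" "a \<le> C * (phi \<theta> powr p - phi (p * \<theta>))"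
    using contract by (auto simp: C_def field_simps max_def)
  have "(\<integral>\<^sup>+w. ennreal (level_sum \<theta> n w powr p) \<partial>E) \<le> ennreal (C * phi \<theta> powr (p * n))" for n
  proof (induction n)
    case 0
    then show ?case using C phi by (simp add: emeasure_space_1)
  next
    case (Suc n)
    have "(\<integral>\<^sup>+w. ennreal (level_sum \<theta> (Suc n) w powr p) \<partial>E)
      \<le> ennreal a * ennreal (phi \<theta> powr (p * n)) + ennreal (phi (p * \<theta>)) * (\<integral>\<^sup>+w. ennreal (level_sum \<theta> n w powr p) \<partial>E)"
      using moment_level_sum_Suc[OF \<theta>(1) p(1,2)] a by simp
    also have "\<dots> \<le> ennreal a * ennreal (phi \<theta> powr (p * n)) + ennreal (phi (p * \<theta>)) * ennreal (C * phi \<theta> powr (p * n))"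
      using Suc.IH by (intro add_left_mono mult_left_mono) auto
    also have "\<dots> = ennreal (a * phi \<theta> powr (p * n) + phi (p * \<theta>) * (C * phi \<theta> powr (p * n)))"
      using a C phi by (simp add: ennreal_plus ennreal_mult)
    also have "\<dots> \<le> ennreal (C * phi \<theta> powr (p * Suc n))"
    proof (rule ennreal_leI)
      have "a * phi \<theta> powr (p * n) + phi (p * \<theta>) * (C * phi \<theta> powr (p * n))
          = (a + C * phi (p * \<theta>)) * phi \<theta> powr (p * n)" by (simp add: algebra_simps)
      also have "\<dots> \<le> (C * phi \<theta> powr p) * phi \<theta> powr (p * n)"
        using C by (intro mult_right_mono) (auto simp: algebra_simps)
      also have "\<dots> = C * phi \<theta> powr (p * Suc n)"
        by (simp add: powr_add[symmetric] algebra_simps)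
      finally show "a * phi \<theta> powr (p * n) + phi (p * \<theta>) * (C * phi \<theta> powr (p * n)) \<le> C * phi \<theta> powr (p * Suc n)" .
    qed
    finally show ?case .
  qed
  then show ?thesis using C unfolding pw by (intro exI[of _ C]) auto
qed

lemma prob_level_sum_ge:
  assumes \<theta>: "0 < \<theta>" "\<theta> < 1" and p: "1 < p" "p \<le> 2" "p * (1 - \<theta>) \<le> 1"
    and contract: "phi (p * \<theta>) < phi \<theta> powr p"
  shows "\<exists>\<delta>>0. \<forall>n. \<delta> \<le> prob {w \<in> space E. phi \<theta> ^ n / 2 \<le> level_sum \<theta> n w}"
proof -
  obtain C where C: "0 < C" "\<And>n. (\<integral>\<^sup>+w. ennreal (level_sum \<theta> n w powr p) \<partial>E) \<le> ennreal (C * (phi \<theta> ^ n) powr p)"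
    using moment_level_sum_bounded[OF assms] by blast
  have "1 / (4 * (4 * C) powr (1 / (p - 1))) \<le> prob {w \<in> space E. phi \<theta> ^ n / 2 \<le> level_sum \<theta> n w}" for n
    using \<theta> p C phi_pos[of \<theta>] by (intro prob_ge_half_mean[OF _ _ nn_integral_level_sum]) auto
  moreover have "0 < 1 / (4 * (4 * C) powr (1 / (p - 1)))" using C by simp
  ultimately show ?thesis by blast
qed

lemma tendsto_prob_level_sum_gt:
  assumes \<theta>: "0 \<le> \<theta>" and \<epsilon>: "0 < \<epsilon>"
  shows "(\<lambda>n. prob {w \<in> space E. (phi \<theta> * exp \<epsilon>) ^ n \<le> level_sum \<theta> n w}) \<longlonglongrightarrow> 0"
proof (rule tendsto_sandwich[of "\<lambda>_. 0"])
  have phi: "0 < phi \<theta>" using \<theta> by (rule phi_pos)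
  show "(\<lambda>n. exp (- \<epsilon>) ^ n) \<longlonglongrightarrow> 0"
    using \<epsilon> by (intro LIMSEQ_power_zero) auto
  have "prob {w \<in> space E. (phi \<theta> * exp \<epsilon>) ^ n \<le> level_sum \<theta> n w} \<le> exp (- \<epsilon>) ^ n" for n
  proof -
    have i: "integrable E (level_sum \<theta> n)"
      by (rule integrableI_nonneg) (use nn_integral_level_sum[OF \<theta>, of n] in auto)
    have "ennreal (\<integral>w. level_sum \<theta> n w \<partial>E) = ennreal (phi \<theta> ^ n)"
      using nn_integral_eq_integral[OF i] nn_integral_level_sum[OF \<theta>, of n] by simp
    then have e: "(\<integral>w. level_sum \<theta> n w \<partial>E) = phi \<theta> ^ n"
      using phi by (subst (asm) ennreal_inj) auto
    have "prob {w \<in> space E. (phi \<theta> * exp \<epsilon>) ^ n \<le> level_sum \<theta> n w} \<le> (\<integral>w. level_sum \<theta> n w \<partial>E) / (phi \<theta> * exp \<epsilon>) ^ n"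
      using phi by (intro integral_Markov_inequality_measure[where A = "{}"] i) auto
    also have "\<dots> = exp (- \<epsilon>) ^ n"
      using phi unfolding e by (simp add: power_mult_distrib exp_minus power_inverse field_simps)
    finally show ?thesis .
  qed
  then show "eventually (\<lambda>n. prob {w \<in> space E. (phi \<theta> * exp \<epsilon>) ^ n \<le> level_sum \<theta> n w} \<le> exp (- \<epsilon>) ^ n) sequentially"
    by simp
qed auto

lemma growth_rate_le:
  assumes lim: "AE w in E. (\<lambda>n. 1 / real n * ln (level_sum 1 n w)) \<longlonglongrightarrow> L"
    and \<theta>: "0 < \<theta>" "\<theta> \<le> 1"
  shows "\<theta> * L \<le> ln (phi \<theta>)"
proof (rule field_le_epsilon)
  fix e :: real assume e: "0 < e"
  define \<epsilon> where "\<epsilon> = e / 2"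
  have \<epsilon>: "0 < \<epsilon>" using e by (simp add: \<epsilon>_def)
  have phi: "0 < phi \<theta>" using \<theta> by (intro phi_pos) auto
  \<comment> \<open>Without leaves the level sums are positive. This matters because of
    \<open>ln 0 = 0\<close>: the logarithm of a vanishing sum would give no information.\<close>
  have p1: "1 \<le> prob {w \<in> space E. 0 < level_sum 1 n w}" for n
  proof -
    have "AE w in E. 0 < level_sum 1 n w"
      using AE_num_children_pos AE_space by eventually_elim (auto intro!: level_sum_pos simp: space_E)
    then have "prob {w \<in> space E. 0 < level_sum 1 n w} = 1"
      by (subst prob_Collect_eq_1) auto
    then show ?thesis by simp
  qed
  have "eventually (\<lambda>n. \<exists>w\<in>{w \<in> space E. 0 < level_sum 1 n w}.
      w \<notin> {w \<in> space E. (phi \<theta> * exp \<epsilon>) ^ n \<le> level_sum \<theta> n w} \<and>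
      w \<notin> {w \<in> space E. \<epsilon> \<le> \<bar>1 / real n * ln (level_sum 1 n w) - L\<bar>}) sequentially"
    by (rule eventually_ex_outside[where \<delta> = 1])
      (use p1 tendsto_prob_level_sum_gt[of \<theta> \<epsilon>] tendsto_prob_deviation[OF _ lim \<epsilon>] \<theta> \<epsilon> in auto)
  then have "eventually (\<lambda>n. 0 < n \<and> (\<exists>w\<in>space E. 0 < level_sum 1 n w \<and> level_sum \<theta> n w < (phi \<theta> * exp \<epsilon>) ^ n
      \<and> \<bar>1 / real n * ln (level_sum 1 n w) - L\<bar> < \<epsilon>)) sequentially"
    using eventually_gt_at_top[of 0] by eventually_elim (force simp: not_le)
  then obtain n w where n: "0 < n" and w: "w \<in> space E" and Z: "0 < level_sum 1 n w"
    and Z\<theta>: "level_sum \<theta> n w < (phi \<theta> * exp \<epsilon>) ^ n"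
    and dev: "\<bar>1 / real n * ln (level_sum 1 n w) - L\<bar> < \<epsilon>"
    by (auto dest!: eventually_happens)
  have "level_sum 1 n w powr \<theta> \<le> (phi \<theta> * exp \<epsilon>) ^ n"
    using level_sum_1_powr_le[of w \<theta> n] w \<theta> Z\<theta> by (simp add: space_E)
  then have "ln (level_sum 1 n w powr \<theta>) \<le> ln ((phi \<theta> * exp \<epsilon>) ^ n)"
    using Z phi by (subst ln_le_cancel_iff) auto
  then have "\<theta> * ln (level_sum 1 n w) \<le> real n * (ln (phi \<theta>) + \<epsilon>)"
    using Z phi by (simp add: ln_powr ln_realpow ln_mult)
  then have "\<theta> * (1 / real n * ln (level_sum 1 n w)) \<le> ln (phi \<theta>) + \<epsilon>"
    using n by (simp add: field_simps)
  moreover have "\<theta> * (L - \<epsilon>) \<le> \<theta> * (1 / real n * ln (level_sum 1 n w))"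
    using dev \<theta> by (intro mult_left_mono) auto
  moreover have "\<theta> * \<epsilon> \<le> \<epsilon>" using \<theta> \<epsilon> by simp
  ultimately show "\<theta> * L \<le> ln (phi \<theta>) + e"
    by (simp add: \<epsilon>_def algebra_simps)
qed

text \<open>Log-convexity in the exponent, with \<open>b\<close> between \<open>a\<close> and 1,
  bounds the sum at 1 from below by those at \<open>b\<close> and \<open>a\<close>. At
  \<open>b\<close> the sum is comparable to its mean with probability bounded away from 0; at
  \<open>a\<close> only an upper bound is required, and Markov's inequality provides it.\<close>

lemma growth_rate_ge:
  assumes lim: "AE w in E. (\<lambda>n. 1 / real n * ln (level_sum 1 n w)) \<longlonglongrightarrow> L"
    and ab: "0 \<le> a" "a < b" "b < 1" and p: "1 < p" "p \<le> 2" "p * (1 - b) \<le> 1"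
    and contract: "phi (p * b) < phi b powr p"
  shows "ln (phi b) + (1 - b) * ((ln (phi b) - ln (phi a)) / (b - a)) \<le> L"
proof -
  define t where "t = (b - a) / (1 - a)"
  have t: "0 < t" "t < 1" and t': "1 - t = (1 - b) / (1 - a)"
    using ab by (auto simp: t_def field_simps)
  have "t * (1 - a) = b - a" using ab by (simp add: t_def)
  then have b: "b = (1 - t) * a + t * 1" by (simp add: algebra_simps)
  have phi: "0 < phi a" "0 < phi b" using ab by (auto intro!: phi_pos)
  obtain \<delta> where \<delta>: "0 < \<delta>" "\<And>n. \<delta> \<le> prob {w \<in> space E. phi b ^ n / 2 \<le> level_sum b n w}"
    using prob_level_sum_ge[of b p] ab p contract by auto
  have "ln (phi b) - (1 - t) * ln (phi a) \<le> t * L"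
  proof (rule field_le_epsilon)
    fix e :: real assume e: "0 < e"
    define \<epsilon> where "\<epsilon> = e / 2"
    have \<epsilon>: "0 < \<epsilon>" using e by (simp add: \<epsilon>_def)
    have "eventually (\<lambda>n. \<exists>w\<in>{w \<in> space E. phi b ^ n / 2 \<le> level_sum b n w}.
        w \<notin> {w \<in> space E. (phi a * exp \<epsilon>) ^ n \<le> level_sum a n w} \<and>
        w \<notin> {w \<in> space E. \<epsilon> \<le> \<bar>1 / real n * ln (level_sum 1 n w) - L\<bar>}) sequentially"
      by (rule eventually_ex_outside[where \<delta> = \<delta>])
        (use \<delta> tendsto_prob_level_sum_gt[of a \<epsilon>] tendsto_prob_deviation[OF _ lim \<epsilon>] ab \<epsilon> in auto)
    moreover have "eventually (\<lambda>n. ln 2 / real n < \<epsilon>) sequentially"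
      using \<epsilon> by (intro order_tendstoD(2)[OF lim_const_over_n])
    ultimately have "eventually (\<lambda>n. 0 < n \<and> ln 2 / real n < \<epsilon> \<and> (\<exists>w\<in>space E. phi b ^ n / 2 \<le> level_sum b n w
        \<and> level_sum a n w < (phi a * exp \<epsilon>) ^ n \<and> \<bar>1 / real n * ln (level_sum 1 n w) - L\<bar> < \<epsilon>)) sequentially"
      using eventually_gt_at_top[of 0] by eventually_elim (force simp: not_le)
    then obtain n w where n: "0 < n" "ln 2 / real n < \<epsilon>" and w: "w \<in> space E"
      and Zb: "phi b ^ n / 2 \<le> level_sum b n w" and Za: "level_sum a n w < (phi a * exp \<epsilon>) ^ n"
      and dev: "\<bar>1 / real n * ln (level_sum 1 n w) - L\<bar> < \<epsilon>"
      by (auto dest!: eventually_happens)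
    have conv: "level_sum b n w \<le> level_sum a n w powr (1 - t) * level_sum 1 n w powr t"
      using level_sum_log_convex[of w t a 1 n] w t b by (simp add: space_E)
    have Zb0: "0 < level_sum b n w"
      using Zb phi by (smt (verit) half_gt_zero zero_less_power)
    \<comment> \<open>If either sum vanished, the right-hand side of \<open>conv\<close> would be
      0.\<close>
    then have "level_sum a n w \<noteq> 0 \<and> level_sum 1 n w \<noteq> 0"
      using conv by (intro conjI notI) simp_all
    then have Z0: "0 < level_sum a n w" "0 < level_sum 1 n w"
      by (simp_all add: less_le)
    have "ln (phi b ^ n / 2) \<le> ln (level_sum b n w)"
      using Zb Zb0 phi by (subst ln_le_cancel_iff) auto
    also have "\<dots> \<le> ln (level_sum a n w powr (1 - t) * level_sum 1 n w powr t)"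
      using conv Zb0 Z0 by (subst ln_le_cancel_iff) auto
    also have "\<dots> = (1 - t) * ln (level_sum a n w) + t * ln (level_sum 1 n w)"
      using Z0 by (simp add: ln_mult ln_powr)
    also have "(1 - t) * ln (level_sum a n w) \<le> (1 - t) * ln ((phi a * exp \<epsilon>) ^ n)"
      using Za Z0 t phi by (intro mult_left_mono) (auto simp: ln_le_cancel_iff)
    finally have "real n * ln (phi b) - ln 2 \<le> (1 - t) * (real n * (ln (phi a) + \<epsilon>)) + t * ln (level_sum 1 n w)"
      using phi by (simp add: ln_div ln_realpow ln_mult)
    then have "(real n * ln (phi b) - ln 2) / real n
        \<le> ((1 - t) * (real n * (ln (phi a) + \<epsilon>)) + t * ln (level_sum 1 n w)) / real n"
      by (rule divide_right_mono) simp
    then have "ln (phi b) - ln 2 / real n \<le> (1 - t) * (ln (phi a) + \<epsilon>) + t * (1 / real n * ln (level_sum 1 n w))"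
      using n by (simp add: diff_divide_distrib add_divide_distrib)
    also have "\<dots> \<le> (1 - t) * (ln (phi a) + \<epsilon>) + t * (L + \<epsilon>)"
      using dev t by (intro add_left_mono mult_left_mono) auto
    also have "\<dots> = (1 - t) * ln (phi a) + t * L + \<epsilon>"
      by (simp add: algebra_simps)
    finally show "ln (phi b) - (1 - t) * ln (phi a) \<le> t * L + e"
      using n(2) \<epsilon>_def by linarith
  qed
  then have "(ln (phi b) - (1 - t) * ln (phi a)) / t \<le> L"
    using t by (simp add: field_simps)
  \<comment> \<open>Dividing by \<open>t = (b - a) / (1 - a)\<close> turns the interpolation
    inequality into the value at 1 of the secant through \<open>a\<close> and
    \<open>b\<close>.\<close>
  moreover have "(ln (phi b) - (1 - t) * ln (phi a)) / t = ln (phi b) + (1 - b) * ((ln (phi b) - ln (phi a)) / (b - a))"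
    using ab unfolding t' t_def by (simp add: divide_simps) (simp add: algebra_simps)
  ultimately show ?thesis by simp
qed

end

section \<open>The logarithmic moment function\<close>

lemma exp_remainder_bound:
  fixes y :: real
  shows "\<bar>exp y - 1 - y\<bar> \<le> y\<^sup>2 * exp \<bar>y\<bar>"
proof -
  have 0: "0 \<le> exp y - 1 - y" using exp_ge_add_one_self[of y] by linarith
  have 1: "exp y - 1 \<le> y * exp y"
  proof -
    have "(1 - exp (- y)) * exp y \<le> y * exp y"
      using exp_ge_add_one_self[of "- y"] by (intro mult_right_mono) auto
    then show ?thesis by (simp add: left_diff_distrib exp_add[symmetric])
  qed
  have "exp y - 1 - y \<le> y\<^sup>2 * exp \<bar>y\<bar>"
  proof (cases "0 \<le> y")
    case True
    have "exp y - 1 - y \<le> y * exp y - y" using 1 by linarith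
    also have "\<dots> = y * (exp y - 1)" by (simp add: algebra_simps)
    also have "\<dots> \<le> y * (y * exp y)" using True 1 by (intro mult_left_mono)
    finally show ?thesis using True by (simp add: power2_eq_square)
  next
    case False
    have "exp y - 1 - y \<le> y * exp y - y" using 1 by linarith
    also have "\<dots> = (- y) * (1 - exp y)" by (simp add: algebra_simps)
    also have "\<dots> \<le> (- y) * (- y)"
      using False exp_ge_add_one_self[of y] by (intro mult_left_mono) linarith+
    also have "\<dots> \<le> y\<^sup>2 * exp \<bar>y\<bar>"
      using mult_left_mono[of 1 "exp \<bar>y\<bar>" "y\<^sup>2"] by (simp add: power2_eq_square)
    finally show ?thesis .
  qed
  with 0 show ?thesis by simp
qed

text \<open>A remainder uniform in \<open>x\<close>, although \<open>ln x\<close> is unbounded near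
  0. Since \<open>h\<close> uses up at most half of the exponent, the factor
  \<open>x powr (\<theta> / 2)\<close> is left to absorb the squared logarithm. With
  \<open>y = - \<theta> / 2 * ln x\<close>, the constant is 4 from
  \<open>(ln x)\<^sup>2 = 4 / \<theta>\<^sup>2 * y\<^sup>2\<close> times 2 from
  \<open>y\<^sup>2 * exp (- y) \<le> 2\<close>.\<close>

lemma powr_taylor_bound:
  fixes x \<theta> h :: real
  assumes x: "0 < x" "x \<le> 1" and \<theta>: "0 < \<theta>" and h: "\<bar>h\<bar> \<le> \<theta> / 2"
  shows "\<bar>x powr (\<theta> + h) - x powr \<theta> - h * (x powr \<theta> * ln x)\<bar> \<le> 8 / \<theta>\<^sup>2 * h\<^sup>2"
proof -
  define u where "u = - ln x"
  have u: "0 \<le> u" using x by (simp add: u_def)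
  have "x powr (\<theta> + h) - x powr \<theta> - h * (x powr \<theta> * ln x) = exp (- \<theta> * u) * (exp (- h * u) - 1 - (- h * u))"
    using x by (simp add: powr_def u_def algebra_simps exp_add[symmetric])
  then have "\<bar>x powr (\<theta> + h) - x powr \<theta> - h * (x powr \<theta> * ln x)\<bar> = exp (- \<theta> * u) * \<bar>exp (- h * u) - 1 - (- h * u)\<bar>"
    by (simp add: abs_mult)
  also have "\<dots> \<le> exp (- \<theta> * u) * ((- h * u)\<^sup>2 * exp \<bar>- h * u\<bar>)"
    by (intro mult_left_mono exp_remainder_bound) auto
  also have "\<dots> \<le> exp (- \<theta> * u) * ((- h * u)\<^sup>2 * exp (\<theta> / 2 * u))"
    using mult_right_mono[OF h u] u by (intro mult_left_mono) (auto simp: abs_mult)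
  also have "\<dots> = h\<^sup>2 * (u\<^sup>2 * exp (- (\<theta> / 2 * u)))"
    by (simp add: power_mult_distrib exp_add[symmetric] algebra_simps)
  also have "\<dots> \<le> h\<^sup>2 * (8 / \<theta>\<^sup>2)"
  proof (rule mult_left_mono)
    define y where "y = \<theta> / 2 * u"
    have y: "0 \<le> y" using \<theta> u by (simp add: y_def)
    have "y\<^sup>2 / 2 \<le> exp y" using exp_lower_Taylor_quadratic[OF y] y by linarith
    then have "y\<^sup>2 * exp (- y) \<le> 2"
      by (simp add: exp_minus field_simps)
    moreover have "u\<^sup>2 = 4 / \<theta>\<^sup>2 * y\<^sup>2" using \<theta> by (simp add: y_def power2_eq_square)
    ultimately show "u\<^sup>2 * exp (- (\<theta> / 2 * u)) \<le> 8 / \<theta>\<^sup>2"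
      unfolding y_def[symmetric] using mult_left_mono[of "y\<^sup>2 * exp (- y)" 2 "4 / \<theta>\<^sup>2"] by simp
  qed simp
  finally show ?thesis by (simp add: mult.commute)
qed

lemma powr_mult_ln_bound:
  fixes x \<theta> :: real
  assumes x: "0 < x" "x \<le> 1" and \<theta>: "0 < \<theta>"
  shows "\<bar>x powr \<theta> * ln x\<bar> \<le> 1 / \<theta>"
proof -
  define u where "u = - ln x"
  have u: "0 \<le> u" using x by (simp add: u_def)
  have "\<theta> * u \<le> exp (\<theta> * u)" using exp_ge_add_one_self[of "\<theta> * u"] by linarith
  then have "u * exp (- \<theta> * u) \<le> 1 / \<theta>" using \<theta> by (simp add: exp_minus field_simps)
  moreover have "\<bar>x powr \<theta> * ln x\<bar> = u * exp (- \<theta> * u)"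
    using x u by (simp add: powr_def u_def abs_mult)
  ultimately show ?thesis by simp
qed

context gw_environment
begin

lemma phi_1_less_1: "phi 1 < 1"
proof -
  have "(\<integral>w. level_sum 1 1 w \<partial>E) < (\<integral>w. 1 \<partial>E)"
  proof (rule integral_less_AE_space)
    show "AE w in E. level_sum 1 1 w < 1"
      using AE_num_children_pos AE_space
    proof eventually_elim
      case (elim w)
      have "level_sum 1 1 w = (\<Sum>j<num_children w []. omega w root (Some [j]))"
        using omega_bounds(1)[of w] elim by simp
      with elim omega_bounds(6)[of w] show ?case by simp
    qed
  qed (use integrable_level_sum_1[of 1] in
      \<open>auto simp: emeasure_space_1 simp del: level_sum.simps One_nat_def\<close>)
  then show ?thesis by (simp add: phi_def prob_space del: level_sum.simps One_nat_def)
qed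

lemma phi_antimono:
  assumes "0 \<le> a" "a \<le> b" shows "phi b \<le> phi a"
  unfolding phi_def
proof (rule integral_mono)
  fix w assume w: "w \<in> space E"
  have "(\<Sum>j<num_children w []. omega w root (Some [j]) powr b) \<le> (\<Sum>j<num_children w []. omega w root (Some [j]) powr a)"
    using assms omega_bounds(1,2)[OF w] by (intro sum_mono powr_mono') auto
  then show "level_sum b 1 w \<le> level_sum a 1 w" by simp
qed (use assms in \<open>auto intro!: integrable_level_sum_1 simp del: level_sum.simps One_nat_def\<close>)

text \<open>Positive weights have powers tending to 1, and \<nu> dominates. With
  \<open>phi_antimono\<close> and a mean above 1 this supplies the interval near 0 on which
  \<open>ln (phi \<theta>)\<close> is nonnegative; the sequence form suits dominated
  convergence.\<close>

lemma tendsto_phi_0: "(\<lambda>n. phi (1 / real (Suc n))) \<longlonglongrightarrow> mean_offspring q"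
  unfolding phi_def integral_num_children[of "[]", symmetric]
proof (rule integral_dominated_convergence[OF _ _ integrable_num_children[of "[]"]])
  show "AE w in E. (\<lambda>n. level_sum (1 / real (Suc n)) 1 w) \<longlonglongrightarrow> real (num_children w [])"
    using AE_space
  proof eventually_elim
    case (elim w)
    have "(\<lambda>n. \<Sum>j<num_children w []. omega w root (Some [j]) powr (1 / real (Suc n)))
        \<longlonglongrightarrow> (\<Sum>j<num_children w []. omega w root (Some [j]) powr 0)"
      using omega_bounds(3)[OF elim]
      by (intro tendsto_sum tendsto_powr' tendsto_const LIMSEQ_Suc[OF lim_1_over_n]) force+
    also have "(\<Sum>j<num_children w []. omega w root (Some [j]) powr 0) = (\<Sum>j<num_children w []. 1)"
      using omega_bounds(3)[OF elim] by (intro sum.cong) force+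
    finally show ?case by simp
  qed
  show "AE w in E. norm (level_sum (1 / real (Suc n)) 1 w) \<le> real (num_children w [])" for n
    using AE_space
  proof eventually_elim
    case (elim w)
    then show ?case
      using level_sum_1_le[of w "1 / real (Suc n)"] by (simp del: level_sum.simps One_nat_def)
  qed
qed measurable

text \<open>Hoelder for the expectation: pointwise log-convexity of the first level sum, then
  Young's inequality after division by the means \<open>phi a\<close> and \<open>phi b\<close>.
  \<open>K\<close> is the resulting bound.\<close>

lemma convex_on_ln_phi: "convex_on {0..} (\<lambda>\<theta>. ln (phi \<theta>))"
proof (rule convex_onI)
  fix t a b :: real
  assume t: "0 < t" "t < 1" and "a \<in> {0..}" "b \<in> {0..}"
  then have ab: "0 \<le> a" "0 \<le> b" by auto
  define c where "c = (1 - t) * a + t * b"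
  have c: "0 \<le> c" using ab t by (simp add: c_def)
  have pos: "0 < phi a" "0 < phi b" "0 < phi c" using ab c by (auto intro: phi_pos)
  define K where "K = phi a powr (1 - t) * phi b powr t"
  have K: "0 < K" using pos by (simp add: K_def)
  have "phi c \<le> (\<integral>w. K * ((1 - t) * (level_sum a 1 w / phi a) + t * (level_sum b 1 w / phi b)) \<partial>E)"
    unfolding phi_def[of c]
  proof (rule integral_mono)
    show "integrable E (level_sum c 1)" by (rule integrable_level_sum_1[OF c])
    show "integrable E (\<lambda>w. K * ((1 - t) * (level_sum a 1 w / phi a) + t * (level_sum b 1 w / phi b)))"
      using integrable_level_sum_1 ab by (simp del: level_sum.simps One_nat_def)
    fix w assume w: "w \<in> space E"
    define x y where "x = level_sum a 1 w" and "y = level_sum b 1 w"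
    have xy: "0 \<le> x" "0 \<le> y" by (simp_all add: x_def y_def del: level_sum.simps)
    have "level_sum c 1 w \<le> x powr (1 - t) * y powr t"
      unfolding c_def x_def y_def using w t by (intro level_sum_log_convex) (auto simp: space_E)
    also have "\<dots> \<le> K * ((1 - t) * (x / phi a) + t * (y / phi b))"
    proof (cases "x = 0 \<or> y = 0")
      case True
      then have "x powr (1 - t) * y powr t = 0" by auto
      moreover have "0 \<le> K * ((1 - t) * (x / phi a) + t * (y / phi b))"
        using K t xy pos by (intro mult_nonneg_nonneg add_nonneg_nonneg) auto
      ultimately show ?thesis by linarith
    next
      case False
      have "x powr (1 - t) * y powr t = K * ((x / phi a) powr (1 - t) * (y / phi b) powr t)"
        using False xy pos by (simp add: K_def powr_divide)
      also have "\<dots> \<le> K * ((1 - t) * (x / phi a) + t * (y / phi b))"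
        using K False xy pos t by (intro mult_left_mono Youngs_inequality_0) auto
      finally show ?thesis .
    qed
    finally show "level_sum c 1 w \<le> K * ((1 - t) * (level_sum a 1 w / phi a) + t * (level_sum b 1 w / phi b))"
      by (simp only: x_def y_def)
  qed
  also have "\<dots> = K * ((1 - t) * (phi a / phi a) + t * (phi b / phi b))"
    using integrable_level_sum_1 ab by (simp add: phi_def del: level_sum.simps One_nat_def)
  also have "\<dots> = K" using pos by simp
  finally have "ln (phi c) \<le> ln K" using pos K by simp
  also have "ln K = (1 - t) * ln (phi a) + t * ln (phi b)"
    using pos by (simp add: K_def ln_mult ln_powr)
  finally show "ln (phi ((1 - t) *\<^sub>R a + t *\<^sub>R b)) \<le> (1 - t) * ln (phi a) + t * ln (phi b)"
    by (simp add: c_def)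
qed simp

text \<open>The Taylor remainder of each weight is bounded uniformly, so the remainder of the sum is
  at most a multiple of \<nu> times \<open>h\<^sup>2\<close>, which is integrable. The derivative is
  the expectation of the termwise derivative \<open>S\<close>.\<close>

lemma phi_differentiable:
  assumes \<theta>: "0 < \<theta>"
  shows "\<exists>D. (phi has_real_derivative D) (at \<theta>)"
proof -
  define S where "S w = (\<Sum>j<num_children w []. omega w root (Some [j]) powr \<theta> * ln (omega w root (Some [j])))" for w
  define D where "D = (\<integral>w. S w \<partial>E)"
  define m where "m = mean_offspring q"
  have m: "0 \<le> m" unfolding m_def integral_num_children[of "[]", symmetric] by simp
  have S: "integrable E S"
  proof (rule Bochner_Integration.integrable_bound[of _ "\<lambda>w. real (num_children w []) * (1 / \<theta>)"])
    show "integrable E (\<lambda>w. real (num_children w []) * (1 / \<theta>))"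
      using integrable_num_children by simp
    show "S \<in> borel_measurable E" unfolding S_def by measurable
    show "AE w in E. norm (S w) \<le> norm (real (num_children w []) * (1 / \<theta>))"
      using AE_space
    proof eventually_elim
      case (elim w)
      have "\<bar>S w\<bar> \<le> (\<Sum>j<num_children w []. \<bar>omega w root (Some [j]) powr \<theta> * ln (omega w root (Some [j]))\<bar>)"
        unfolding S_def by (rule sum_abs)
      also have "\<dots> \<le> (\<Sum>j<num_children w []. 1 / \<theta>)"
        by (rule sum_mono, rule powr_mult_ln_bound[OF omega_bounds(3,2)[OF elim] \<theta>]) simp
      finally show ?case using \<theta> by simp
    qed
  qed
  have est: "\<bar>phi (\<theta> + h) - phi \<theta> - h * D\<bar> \<le> (m * (8 / \<theta>\<^sup>2)) * h\<^sup>2" if h: "\<bar>h\<bar> \<le> \<theta> / 2" for h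
  proof -
    have i: "integrable E (level_sum (\<theta> + h) 1)" "integrable E (level_sum \<theta> 1)"
      using \<theta> h by (auto intro!: integrable_level_sum_1 simp del: level_sum.simps One_nat_def)
    let ?r = "\<lambda>w. level_sum (\<theta> + h) 1 w - level_sum \<theta> 1 w - h * S w"
    have r: "\<bar>?r w\<bar> \<le> real (num_children w []) * (8 / \<theta>\<^sup>2 * h\<^sup>2)" if w: "w \<in> space E" for w
    proof -
      let ?o = "\<lambda>j. omega w root (Some [j])"
      have "\<bar>?r w\<bar> = \<bar>\<Sum>j<num_children w []. ?o j powr (\<theta> + h) - ?o j powr \<theta> - h * (?o j powr \<theta> * ln (?o j))\<bar>"
        by (simp add: S_def sum_subtractf sum_distrib_left)
      also have "\<dots> \<le> (\<Sum>j<num_children w []. 8 / \<theta>\<^sup>2 * h\<^sup>2)"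
        by (rule order_trans[OF sum_abs], rule sum_mono,
            rule powr_taylor_bound[OF omega_bounds(3,2)[OF w] \<theta> h]) simp
      finally show ?thesis by simp
    qed
    have r_int: "integrable E ?r"
      using i S by (simp del: level_sum.simps One_nat_def)
    have "\<bar>phi (\<theta> + h) - phi \<theta> - h * D\<bar> = \<bar>\<integral>w. ?r w \<partial>E\<bar>"
      using i S by (simp add: phi_def D_def del: level_sum.simps One_nat_def)
    also have "\<dots> \<le> (\<integral>w. real (num_children w []) * (8 / \<theta>\<^sup>2 * h\<^sup>2) \<partial>E)"
      by (rule order_trans[OF integral_abs_bound], rule integral_mono)
        (use r r_int integrable_num_children in \<open>simp_all del: level_sum.simps One_nat_def\<close>)
    also have "\<dots> = (m * (8 / \<theta>\<^sup>2)) * h\<^sup>2"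
      by (simp add: integral_num_children m_def)
    finally show ?thesis .
  qed
  have "(\<lambda>h. (phi (\<theta> + h) - phi \<theta>) / h) \<midarrow>0\<rightarrow> D"
  proof (rule LIM_zero_cancel, rule Lim_null_comparison)
    have "eventually (\<lambda>h. h \<in> {- (\<theta> / 2)<..<\<theta> / 2}) (at (0::real))"
      by (intro eventually_at_in_open') (use \<theta> in auto)
    moreover have "eventually (\<lambda>h. h \<noteq> 0) (at (0::real))" by (rule eventually_neq_at_within)
    ultimately show "eventually (\<lambda>h. norm ((phi (\<theta> + h) - phi \<theta>) / h - D) \<le> (m * (8 / \<theta>\<^sup>2)) * \<bar>h\<bar>) (at 0)"
    proof eventually_elim
      case (elim h)
      have "\<bar>phi (\<theta> + h) - phi \<theta> - h * D\<bar> / \<bar>h\<bar> \<le> (m * (8 / \<theta>\<^sup>2)) * h\<^sup>2 / \<bar>h\<bar>"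
        using elim by (intro divide_right_mono est) auto
      moreover have "\<bar>(phi (\<theta> + h) - phi \<theta>) / h - D\<bar> = \<bar>phi (\<theta> + h) - phi \<theta> - h * D\<bar> / \<bar>h\<bar>"
        using elim by (simp only: abs_divide[symmetric]) (simp add: diff_divide_distrib)
      moreover have "h\<^sup>2 / \<bar>h\<bar> = \<bar>h\<bar>" using elim by (simp add: power2_eq_square abs_if)
      ultimately show ?case by (simp only: real_norm_def times_divide_eq_right[symmetric])
    qed
    show "((\<lambda>h. (m * (8 / \<theta>\<^sup>2)) * \<bar>h\<bar>) \<longlongrightarrow> 0) (at 0)"
      by (intro tendsto_mult_right_zero tendsto_rabs_zero tendsto_ident_at)
  qed
  then show ?thesis unfolding DERIV_def by blast
qed

lemma ln_phi_differentiable: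
  assumes "0 < \<theta>"
  shows "\<exists>D. ((\<lambda>\<theta>. ln (phi \<theta>)) has_real_derivative D) (at \<theta>)"
proof -
  obtain D where "(phi has_real_derivative D) (at \<theta>)" using phi_differentiable[OF assms] by blast
  moreover have "0 < phi \<theta>" using assms by (intro phi_pos) simp
  ultimately show ?thesis by (auto intro!: exI derivative_eq_intros)
qed

end

section \<open>The rate functions at 1\<close>

text \<open>Puts 1 into \<open>{1..1 / v}\<close> for positive \<open>v\<close>, so that the
  hypotheses on the rate functions apply at 1.\<close>

lemma speed_le_1:
  assumes law: "positive_law \<mu>" and speed: "is_speed q \<mu> v"
  shows "v \<le> 1"
proof -
  have "prob_space (environment_law q \<mu>)"
    unfolding environment_law_def
    by (intro prob_space_PiM prob_space_pair measure_pmf.prob_space_axioms)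
      (use law in \<open>simp add: positive_law_def\<close>)
  then interpret prob_space "environment_law q \<mu>" .
  have "AE w in environment_law q \<mu>. v \<le> 1"
    using speed[unfolded is_speed_def] AE_space
  proof eventually_elim
    case (elim w)
    interpret Q: prob_space "quenched_law w root" by (rule prob_space_quenched_law)
    have pos: "Aval w x > 0" for x using environment_positive[OF law elim(2)] .
    have "AE X in quenched_law w root. v \<le> 1"
      using elim(1) AE_quenched_path[OF pos]
    proof eventually_elim
      case (elim X)
      have "gen (X n) \<le> int n" for n
        using gen_diff_le[of X 0 n] elim(2) by simp
      then have "real_of_int (gen (X n)) \<le> real n" for n
        by (metis of_int_le_iff of_int_of_nat_eq)
      then have "real_of_int (gen (X n)) / real n \<le> 1" for n
        by (cases "n = 0") (simp_all add: divide_le_eq_1)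
      then show ?case by (intro LIMSEQ_le_const2[OF elim(1)]) auto
    qed
    then show ?case by simp
  qed
  then show ?thesis by simp
qed

context gw_environment
begin

lemma annealed_prob_hit_event:
  assumes "0 < n"
  shows "annealed_prob q \<mu> root (hit_event n 0 1) = phi 1 ^ n"
proof -
  have phi: "0 < phi 1" by (rule phi_pos) simp
  have "annealed_prob q \<mu> root (hit_event n 0 1) = (\<integral>w. level_sum 1 n w \<partial>E)"
    unfolding annealed_prob_def using assms
    by (intro Bochner_Integration.integral_cong refl measure_hit_event) (auto simp: space_E)
  also have "\<dots> = enn2real (\<integral>\<^sup>+w. ennreal (level_sum 1 n w) \<partial>E)"
    by (rule integral_eq_nn_integral) auto
  also have "\<dots> = phi 1 ^ n"
    using nn_integral_level_sum[of 1 n] phi by simp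
  finally show ?thesis .
qed

lemma annealed_rate_at_1:
  assumes "annealed_rate q \<mu> v I" "1 \<in> {1..1 / v}"
  shows "I 1 = - psi q \<mu> 1"
proof -
  have phi: "0 < phi 1" by (rule phi_pos) simp
  \<comment> \<open>With \<open>a = 0\<close> the event says that the hitting time is at most
    \<open>n\<close>, since it is almost surely at least \<open>n > 0\<close>.\<close>
  have "(\<lambda>n. 1 / real n * ln (annealed_prob q \<mu> root (hit_event n 0 1))) \<longlonglongrightarrow> - I 1"
    using assms(1)[unfolded annealed_rate_def, rule_format, of 0 1] assms(2) by simp
  moreover have "eventually (\<lambda>n. 1 / real n * ln (annealed_prob q \<mu> root (hit_event n 0 1)) = ln (phi 1)) sequentially"
    using eventually_gt_at_top[of 0]
    by eventually_elim (use phi in \<open>simp add: annealed_prob_hit_event ln_realpow\<close>)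
  then have "(\<lambda>n. 1 / real n * ln (annealed_prob q \<mu> root (hit_event n 0 1))) \<longlonglongrightarrow> ln (phi 1)"
    by (rule tendsto_eventually)
  ultimately have "- I 1 = ln (phi 1)" by (rule LIMSEQ_unique)
  then show ?thesis by (simp add: psi_eq_ln_phi)
qed

lemma quenched_rate_at_1:
  assumes "quenched_rate q \<mu> v I" "1 \<in> {1..1 / v}" and mean: "1 < mean_offspring q"
  shows "- I 1 = (INF \<theta>\<in>{0<..1}. 1 / \<theta> * psi q \<mu> \<theta>)"
    and "bdd_below ((\<lambda>\<theta>. 1 / \<theta> * psi q \<mu> \<theta>) ` {0<..1})"
proof -
  have "AE w in E. (\<lambda>n. 1 / real n * ln (measure (quenched_law w root) (hit_event n 0 1))) \<longlonglongrightarrow> - I 1"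
    using assms(1)[unfolded quenched_rate_def, rule_format, of 0 1] assms(2) by simp
  then have lim: "AE w in E. (\<lambda>n. 1 / real n * ln (level_sum 1 n w)) \<longlonglongrightarrow> - I 1"
    using AE_space
  proof eventually_elim
    case (elim w)
    have "eventually (\<lambda>n. 1 / real n * ln (measure (quenched_law w root) (hit_event n 0 1))
        = 1 / real n * ln (level_sum 1 n w)) sequentially"
      using eventually_gt_at_top[of 0]
      by eventually_elim (use elim(2) in \<open>simp add: measure_hit_event space_E\<close>)
    with elim(1) show ?case by (rule Lim_transform_eventually)
  qed
  have "eventually (\<lambda>n. 1 < phi (1 / real (Suc n))) sequentially"
    using mean by (rule order_tendstoD(1)[OF tendsto_phi_0])
  then obtain n where n: "1 < phi (1 / real (Suc n))"
    by (auto dest: eventually_happens)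
  have nonneg: "0 \<le> ln (phi \<theta>)" if "0 < \<theta>" "\<theta> \<le> 1 / real (Suc n)" for \<theta>
    using phi_antimono[of \<theta> "1 / real (Suc n)"] n that by simp
  have upper: "\<theta> * - I 1 \<le> ln (phi \<theta>)" if "0 < \<theta>" "\<theta> \<le> 1" for \<theta>
    using growth_rate_le[OF lim that] .
  have "- I 1 \<le> 1 / \<theta> * ln (phi \<theta>)" if "0 < \<theta>" "\<theta> \<le> 1" for \<theta>
    using upper[OF that] that by (simp add: field_simps)
  \<comment> \<open>The limit \<open>- I 1\<close> is a real lower bound; an infimum of reals bounds
    its set from below only when such a bound exists.\<close>
  then show "bdd_below ((\<lambda>\<theta>. 1 / \<theta> * psi q \<mu> \<theta>) ` {0<..1})"
    unfolding psi_eq_ln_phi by (intro bdd_belowI[of _ "- I 1"]) auto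
  show "- I 1 = (INF \<theta>\<in>{0<..1}. 1 / \<theta> * psi q \<mu> \<theta>)" unfolding psi_eq_ln_phi
  proof (rule minimal_slope_eqI[OF convex_on_ln_phi ln_phi_differentiable _ nonneg])
    show "ln (phi 1) < 0" using phi_1_less_1 phi_pos[of 1] by simp
    show "\<theta> * - I 1 \<le> ln (phi \<theta>)" if "0 < \<theta>" "\<theta> \<le> 1" for \<theta>
      using upper[OF that] .
    fix a b p :: real
    assume *: "0 < a" "a < b" "b < 1" "1 < p" "p \<le> 2" "p * (1 - b) \<le> 1" "ln (phi (p * b)) < p * ln (phi b)"
    have pos: "0 < phi b" "0 < phi (p * b)" using * by (auto intro!: phi_pos)
    have "ln (phi (p * b)) < ln (phi b powr p)" using * pos by (simp add: ln_powr)
    then have "phi (p * b) < phi b powr p"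
      by (subst (asm) ln_less_cancel_iff) (use pos in auto)
    then show "ln (phi b) + (1 - b) * ((ln (phi b) - ln (phi a)) / (b - a)) \<le> - I 1"
      using growth_rate_ge[OF lim, of a b p] * by simp
  qed simp_all
qed

end

theorem proposition1p3:
  fixes q :: "nat pmf" and \<mu> :: "real measure" and v :: real and Ia Iq :: "real \<Rightarrow> real"
  assumes "pmf q 0 = 0"
    and "integrable (measure_pmf q) real"
    and "1 < mean_offspring q"
    and "positive_law \<mu>"
    and "0 < ess_inf \<mu>" and "ess_inf \<mu> \<le> ess_sup \<mu>" and "ess_sup \<mu> < \<infinity>"
    and "(INF t\<in>{0..1}. moment \<mu> t) > ennreal (1 / mean_offspring q)"
    and "Lambda q \<mu> > 1"
    and "is_speed q \<mu> v" and "0 < v"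
    and "annealed_rate q \<mu> v Ia"
    and "quenched_rate q \<mu> v Iq"
  shows "Ia 1 = - psi q \<mu> 1
    \<and> Iq 1 = - (INF \<theta>\<in>{0<..1}. 1 / \<theta> * psi q \<mu> \<theta>)
    \<and> (Ia 1 = Iq 1 \<longleftrightarrow> deriv (psi q \<mu>) 1 \<le> psi q \<mu> 1)
    \<and> (\<not> deriv (psi q \<mu>) 1 \<le> psi q \<mu> 1 \<longrightarrow> Ia 1 < Iq 1)"
proof -
  interpret gw_environment q \<mu>
    using assms by unfold_locales
  let ?inf = "INF \<theta>\<in>{0<..1}. 1 / \<theta> * psi q \<mu> \<theta>"
  have psi: "psi q \<mu> = (\<lambda>\<theta>. ln (phi \<theta>))" by (simp add: psi_eq_ln_phi fun_eq_iff)
  have v: "1 \<in> {1..1 / v}"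
    using speed_le_1[OF \<open>positive_law \<mu>\<close> \<open>is_speed q \<mu> v\<close>] \<open>0 < v\<close> by simp
  have Ia: "Ia 1 = - psi q \<mu> 1"
    using \<open>annealed_rate q \<mu> v Ia\<close> v by (rule annealed_rate_at_1)
  have Iq: "- Iq 1 = ?inf" and bdd: "bdd_below ((\<lambda>\<theta>. 1 / \<theta> * psi q \<mu> \<theta>) ` {0<..1})"
    using quenched_rate_at_1[OF \<open>quenched_rate q \<mu> v Iq\<close> v \<open>1 < mean_offspring q\<close>] by auto
  obtain D where D: "(psi q \<mu> has_real_derivative D) (at 1)"
    using ln_phi_differentiable[of 1] by (auto simp: psi)
  have "?inf = psi q \<mu> 1 \<longleftrightarrow> D \<le> psi q \<mu> 1"
    by (rule INF_slope_eq_at_1_iff[OF _ D bdd]) (simp add: psi convex_on_ln_phi)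
  \<comment> \<open>The exponent 1 is admissible in the infimum, so failure of equality already
    means \<open>Ia 1 < Iq 1\<close>.\<close>
  moreover have "?inf \<le> psi q \<mu> 1"
    using cINF_lower[OF bdd, of 1] by simp
  moreover have "deriv (psi q \<mu>) 1 = D" using D by (rule DERIV_imp_deriv)
  ultimately show ?thesis using Ia Iq by auto
qed

end
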